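(* Let $\lambda\in\mathrm{Spec}_{\mathrm{disc}}\,M$ and assume that $(\delta(n))_{n\in\mathbb{N}}$ is a sequence of positive numbers with $\delta(n)\to 0$ as $n\to\infty$ such that for all $\psi\in\mathrm{Dom}\,M$ with $M\psi=\lambda\psi$ and $\|\psi\|=1$, $$\|\Pi_nM^k\Pi_n\psi-\lambda^k\psi\|\le\delta(n)\qquad\text{for all } n\in\mathbb{N}\text{ and } k=0,1,2.$$ Then there exist a constant $b>0$ independent of $n$ and points $z_n\in\mathrm{Spec}\,P_n$ such that $$|z_n-\lambda|<b\,[\delta(n)]^{1/2},\qquad n\in\mathbb{N}.$$
   Context: $M$ is a (possibly unbounded) self-adjoint operator with dense domain $\mathrm{Dom}\,M$ in a separable complex Hilbert space $\mathcal{H}$. $\mathrm{Spec}_{\mathrm{disc}}\,M$ is the set of isolated eigenvalues of $M$ of finite multiplicity. $(\Pi_n)_{n\in\mathbb{N}}$ is a sequence of orthogonal projections on $\mathcal{H}$ whose ranges $\mathcal{L}_n:=\mathrm{Ran}\,\Pi_n$ are nonzero, finite-dimensional and contained in $\mathrm{Dom}\,M^2$. For $z\in\mathbb{C}$ define the quadratic matrix polynomial $$P_n(z):=\Pi_n(z-M)^2|_{\mathcal{L}_n}=z^2-2zM_n+[M^2]_n,\qquad M_n:=\Pi_nM|_{\mathcal{L}_n},\quad [M^2]_n:=\Pi_nM^2|_{\mathcal{L}_n},$$ acting on $\mathcal{L}_n$, and $\mathrm{Spec}\,P_n:=\{z\in\mathbb{C}:\det P_n(z)=0\}$. *)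

theory Defs
  imports "HOL-Analysis.Analysis" "Jordan_Normal_Form.Determinant"
begin

section \<open>Complex Hilbert spaces\<close>

text \<open>The inner product is conjugate-linear in its first argument.\<close>

class complex_inner = real_normed_vector +
  fixes scaleC :: "complex \<Rightarrow> 'a \<Rightarrow> 'a" (infixr "*\<^sub>C" 75)
    and cinner :: "'a \<Rightarrow> 'a \<Rightarrow> complex"
  assumes scaleR_scaleC: "scaleR r x = complex_of_real r *\<^sub>C x"
    and scaleC_add_right: "a *\<^sub>C (x + y) = a *\<^sub>C x + a *\<^sub>C y"
    and scaleC_add_left: "(a + b) *\<^sub>C x = a *\<^sub>C x + b *\<^sub>C x"
    and scaleC_scaleC: "a *\<^sub>C (b *\<^sub>C x) = (a * b) *\<^sub>C x"
    and scaleC_one: "1 *\<^sub>C x = x"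
    and cinner_commute: "cinner x y = cnj (cinner y x)"
    and cinner_add_right: "cinner x (y + z) = cinner x y + cinner x z"
    and cinner_scaleC_right: "cinner x (a *\<^sub>C y) = a * cinner x y"
    and norm_cinner: "cinner x x = complex_of_real ((norm x)\<^sup>2)"

class chilbert_space = complex_inner + complete_space

instantiation complex :: chilbert_space
begin
definition "scaleC_complex = (\<lambda>a x :: complex. a * x)"
definition "cinner_complex = (\<lambda>x y :: complex. cnj x * y)"
instance
proof
  fix x :: complex
  show "cinner x x = complex_of_real ((norm x)\<^sup>2)"
    unfolding cinner_complex_def by (metis complex_norm_square mult.commute)
qed (auto simp: scaleC_complex_def cinner_complex_def algebra_simps scaleR_conv_of_real)
end

global_interpretation complex_vector:
  vector_space "scaleC :: complex \<Rightarrow> 'a::complex_inner \<Rightarrow> 'a"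
  by unfold_locales
    (auto simp: scaleC_add_right scaleC_add_left scaleC_scaleC scaleC_one)

definition fin_dim :: "'a::complex_inner set \<Rightarrow> bool" where
  "fin_dim S \<longleftrightarrow> (\<exists>B. finite B \<and> complex_vector.span B = S)"

definition orth_projection :: "('a::complex_inner \<Rightarrow> 'a) \<Rightarrow> bool" where
  "orth_projection P \<longleftrightarrow>
     Vector_Spaces.linear scaleC scaleC P \<and> (\<forall>x. P (P x) = P x) \<and>
     (\<forall>x y. cinner (P x) y = cinner x (P y))"


section \<open>Unbounded operators\<close>

text \<open>
  An operator is given by its domain D and a function M whose values outside D are irrelevant.
\<close>

definition operator_on :: "'a::complex_inner set \<Rightarrow> ('a \<Rightarrow> 'a) \<Rightarrow> bool" where
  "operator_on D M \<longleftrightarrow>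
     complex_vector.subspace D \<and>
     (\<forall>x\<in>D. \<forall>y\<in>D. M (x + y) = M x + M y) \<and>
     (\<forall>a. \<forall>x\<in>D. M (a *\<^sub>C x) = a *\<^sub>C M x)"

definition adj_dom :: "'a::complex_inner set \<Rightarrow> ('a \<Rightarrow> 'a) \<Rightarrow> 'a set" where
  "adj_dom D M = {y. \<exists>w. \<forall>x\<in>D. cinner y (M x) = cinner w x}"

definition adj :: "'a::complex_inner set \<Rightarrow> ('a \<Rightarrow> 'a) \<Rightarrow> 'a \<Rightarrow> 'a" where
  "adj D M y = (THE w. \<forall>x\<in>D. cinner y (M x) = cinner w x)"

definition self_adjoint :: "'a::complex_inner set \<Rightarrow> ('a \<Rightarrow> 'a) \<Rightarrow> bool" where
  "self_adjoint D M \<longleftrightarrow>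
     operator_on D M \<and> closure D = UNIV \<and>
     adj_dom D M = D \<and> (\<forall>x\<in>D. adj D M x = M x)"

definition dom_square :: "'a set \<Rightarrow> ('a \<Rightarrow> 'a) \<Rightarrow> 'a set" where
  "dom_square D M = {x \<in> D. M x \<in> D}"

definition shifted :: "('a::complex_inner \<Rightarrow> 'a) \<Rightarrow> complex \<Rightarrow> 'a \<Rightarrow> 'a" where
  "shifted M z x = z *\<^sub>C x - M x"

text \<open>
  Complex linearity of the resolvent R is automatic, since R inverts a complex linear map.
\<close>

definition resolvent_set :: "'a::complex_inner set \<Rightarrow> ('a \<Rightarrow> 'a) \<Rightarrow> complex set" where
  "resolvent_set D M = {z. \<exists>R. bounded_linear R \<and>
     (\<forall>y. R y \<in> D \<and> shifted M z (R y) = y) \<and>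
     (\<forall>x\<in>D. R (shifted M z x) = x)}"

definition spectrum :: "'a::complex_inner set \<Rightarrow> ('a \<Rightarrow> 'a) \<Rightarrow> complex set" where
  "spectrum D M = - resolvent_set D M"

definition eigenspace :: "'a::complex_inner set \<Rightarrow> ('a \<Rightarrow> 'a) \<Rightarrow> complex \<Rightarrow> 'a set" where
  "eigenspace D M z = {x \<in> D. M x = z *\<^sub>C x}"

text \<open>
  The multiplicity is the dimension of the eigenspace; for a self-adjoint operator this is
  also the algebraic multiplicity.
\<close>

definition disc_spectrum :: "'a::complex_inner set \<Rightarrow> ('a \<Rightarrow> 'a) \<Rightarrow> complex set" where
  "disc_spectrum D M =
     {z. z isolated_in spectrum D M \<and> eigenspace D M z \<noteq> {0} \<and> fin_dim (eigenspace D M z)}"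


section \<open>Determinants and the quadratic projected spectrum\<close>

definition ordered_basis :: "'a::complex_inner set \<Rightarrow> 'a list \<Rightarrow> bool" where
  "ordered_basis L bs \<longleftrightarrow>
     distinct bs \<and> complex_vector.independent (set bs) \<and> complex_vector.span (set bs) = L"

definition matrix_wrt :: "'a::complex_inner list \<Rightarrow> ('a \<Rightarrow> 'a) \<Rightarrow> complex mat" where
  "matrix_wrt bs T = mat (length bs) (length bs)
     (\<lambda>(i, j). complex_vector.representation (set bs) (T (bs ! j)) (bs ! i))"

text \<open>
  The determinant of a linear map T of a finite-dimensional subspace L into itself; it does not
  depend on the basis chosen.
\<close>

definition op_det :: "'a::complex_inner set \<Rightarrow> ('a \<Rightarrow> 'a) \<Rightarrow> complex" where
  "op_det L T = Determinant.det (matrix_wrt (SOME bs. ordered_basis L bs) T)"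

definition quad_poly ::
    "('a::complex_inner \<Rightarrow> 'a) \<Rightarrow> ('a \<Rightarrow> 'a) \<Rightarrow> complex \<Rightarrow> 'a \<Rightarrow> 'a" where
  "quad_poly M P z x = P (shifted M z (shifted M z x))"

definition quad_spectrum :: "('a::complex_inner \<Rightarrow> 'a) \<Rightarrow> ('a \<Rightarrow> 'a) \<Rightarrow> complex set" where
  "quad_spectrum M P = {z. op_det (range P) (quad_poly M P z) = 0}"

lemma quad_poly_expand:
  assumes M: "operator_on D M" and P: "orth_projection P"
    and sub: "range P \<subseteq> dom_square D M" and x: "x \<in> range P"
  shows "quad_poly M P z x = z\<^sup>2 *\<^sub>C x - (2 * z) *\<^sub>C P (M x) + P (M (M x))"
proof -
  interpret P: Vector_Spaces.linear scaleC scaleC P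
    using P by (simp add: orth_projection_def)
  have D: "x \<in> D" "M x \<in> D" and Px: "P x = x"
    using sub x P by (auto simp: dom_square_def orth_projection_def)
  have sD: "complex_vector.subspace D"
    and add: "\<And>x y. x \<in> D \<Longrightarrow> y \<in> D \<Longrightarrow> M (x + y) = M x + M y"
    and scale: "\<And>a x. x \<in> D \<Longrightarrow> M (a *\<^sub>C x) = a *\<^sub>C M x"
    using M by (auto simp: operator_on_def)
  have "M (z *\<^sub>C x + (-1) *\<^sub>C M x) = z *\<^sub>C M x + (-1) *\<^sub>C M (M x)"
    using D sD by (simp only: add scale complex_vector.subspace_scale)
  then have "M (z *\<^sub>C x - M x) = z *\<^sub>C M x - M (M x)"
    by (simp add: complex_vector.scale_minus_left scaleC_one)
  then have "quad_poly M P z x = P (z *\<^sub>C (z *\<^sub>C x - M x) - (z *\<^sub>C M x - M (M x)))"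
    by (simp only: quad_poly_def shifted_def)
  also have "\<dots> = P (z *\<^sub>C (z *\<^sub>C x) - z *\<^sub>C M x - z *\<^sub>C M x + M (M x))"
    by (simp add: complex_vector.scale_right_diff_distrib algebra_simps)
  also have "\<dots> = z\<^sup>2 *\<^sub>C x - (z *\<^sub>C P (M x) + z *\<^sub>C P (M x)) + P (M (M x))"
    by (simp add: P.diff P.add P.scale Px scaleC_scaleC power2_eq_square)
  also have "z *\<^sub>C P (M x) + z *\<^sub>C P (M x) = (2 * z) *\<^sub>C P (M x)"
    by (metis mult_2 scaleC_add_left)
  finally show ?thesis .
qed

end

theory Submission
  imports Defs "HOL-Complex_Analysis.Complex_Analysis" "HOL-Real_Asymp.Real_Asymp"
begin

text \<open>
  Write N = M - \<open>\<lambda>\<close> and \<open>L\<^sub>n\<close> for the range of \<open>\<Pi>\<^sub>n\<close>. Since \<open>\<lambda>\<close> is real, N is self-adjoint, 0 is an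
  eigenvalue of N that is isolated in its spectrum, and the quadratic polynomial at \<open>\<lambda> + \<zeta>\<close> is
  \<open>T \<zeta> = \<Pi>\<^sub>n (\<zeta> - N)\<^sup>2 = \<zeta>\<^sup>2 - 2 \<zeta> \<Pi>\<^sub>n N + \<Pi>\<^sub>n N\<^sup>2\<close> on \<open>L\<^sub>n\<close>. By hypothesis the last two coefficients are of order
  \<open>\<delta> n\<close> on the projected eigenvectors \<open>\<Pi>\<^sub>n \<psi>\<close>, where \<open>T \<zeta>\<close> is therefore \<open>\<zeta>\<^sup>2\<close> up to an error of that order.

  Two facts turn this into an eigenvalue. The first is the spectral gap \<open>isolated_spectral_gap\<close>: N is
  bounded below away from its kernel. Through \<open>quad_poly_lower_bound\<close> it shows that on a circle
  \<open>\<bar>\<zeta>\<bar> = r\<close>, with r a fixed multiple of \<open>sqrt (\<delta> n)\<close> and n large, \<open>T \<zeta>\<close> is bounded below by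
  \<open>r\<^sup>2 / 4\<close> on all of \<open>L\<^sub>n\<close>. The second is \<open>det_zero_in_disc\<close>: if \<open>T \<zeta>\<close> were invertible in the whole disc, then for
  \<open>e = \<Pi>\<^sub>n \<psi>\<close> the holomorphic function \<open>\<zeta>\<^sup>2 \<langle>e, (T \<zeta>)\<^sup>-\<^sup>1 e\<rangle>\<close> would be near \<open>\<parallel>e\<parallel>\<^sup>2\<close> on the circle and 0 at the
  centre, against the maximum principle. So \<open>T \<zeta>\<close> is singular for some \<open>\<bar>\<zeta>\<bar> \<le> r\<close>.

  For the finitely many remaining n it is enough that the spectrum of the quadratic polynomial is never
  empty (\<open>quad_spectrum_nonempty\<close>); the constant b is then enlarged.

  The spectral gap is obtained without the spectral theorem, from the norm of the bounded symmetric
  operator \<open>(N\<^sup>2 - \<sigma>\<^sup>2)\<^sup>-\<^sup>1\<close> and the resolvent at small imaginary points.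
\<close>

section \<open>The inner product\<close>

lemma cinner_add_left: "cinner (x + y) z = cinner x z + cinner y (z :: 'a::complex_inner)"
  by (metis cinner_add_right cinner_commute complex_cnj_add)

lemma cinner_scaleC_left: "cinner (a *\<^sub>C x) y = cnj a * cinner x (y :: 'a::complex_inner)"
  by (metis cinner_commute cinner_scaleC_right complex_cnj_mult)

lemma cinner_zero_left [simp]: "cinner 0 (y :: 'a::complex_inner) = 0"
  using cinner_add_left[of 0 0 y] by simp

lemma cinner_zero_right [simp]: "cinner (y :: 'a::complex_inner) 0 = 0"
  using cinner_add_right[of y 0 0] by simp

lemma cinner_minus_right: "cinner x (- y) = - cinner x (y :: 'a::complex_inner)"
  by (metis add.right_inverse cinner_add_right cinner_zero_right eq_neg_iff_add_eq_0 add.commute)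

lemma cinner_minus_left: "cinner (- x) y = - cinner x (y :: 'a::complex_inner)"
  by (metis cinner_commute cinner_minus_right complex_cnj_minus)

lemma cinner_diff_right: "cinner x (y - z) = cinner x y - cinner x (z :: 'a::complex_inner)"
  by (simp add: diff_conv_add_uminus cinner_add_right cinner_minus_right del: add_uminus_conv_diff)

lemma cinner_diff_left: "cinner (x - y) z = cinner x z - cinner y (z :: 'a::complex_inner)"
  by (simp add: diff_conv_add_uminus cinner_add_left cinner_minus_left del: add_uminus_conv_diff)

lemma cinner_sum_right: "cinner x (sum f A) = (\<Sum>i\<in>A. cinner x (f i :: 'a::complex_inner))"
  by (induction A rule: infinite_finite_induct) (auto simp: cinner_add_right)

lemma norm_scaleC: "norm (a *\<^sub>C (x :: 'a::complex_inner)) = cmod a * norm x"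
proof -
  have "complex_of_real ((norm (a *\<^sub>C x))\<^sup>2) = a * cnj a * complex_of_real ((norm x)\<^sup>2)"
    by (simp only: norm_cinner[symmetric] cinner_scaleC_left cinner_scaleC_right mult_ac)
  also have "\<dots> = complex_of_real ((cmod a * norm x)\<^sup>2)"
    by (simp add: complex_norm_square[symmetric] power_mult_distrib)
  finally have "(norm (a *\<^sub>C x))\<^sup>2 = (cmod a * norm x)\<^sup>2"
    by (simp only: of_real_eq_iff)
  then show ?thesis by simp
qed

lemma norm_sq_diff:
  "(norm (x - y))\<^sup>2 = (norm x)\<^sup>2 - 2 * Re (cinner x y) + (norm (y :: 'a::complex_inner))\<^sup>2"
proof -
  have "Re (cinner (x - y) (x - y)) = Re (cinner x x) - Re (cinner x y) - Re (cinner y x) + Re (cinner y y)"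
    by (simp add: cinner_diff_left cinner_diff_right)
  moreover have "Re (cinner y x) = Re (cinner x y)"
    by (metis cinner_commute complex_cnj(1) complex_surj complex.sel(1))
  ultimately show ?thesis by (simp add: norm_cinner)
qed

lemma Cauchy_Schwarz_cinner: "cmod (cinner x y) \<le> norm x * norm (y :: 'a::complex_inner)"
proof (cases "x = 0")
  case False
  define c where "c = cinner x y / complex_of_real ((norm x)\<^sup>2)"
  have "cinner x (y - c *\<^sub>C x) = 0"
    using False by (simp add: cinner_diff_right cinner_scaleC_right c_def norm_cinner)
  then have "cinner (c *\<^sub>C x) (y - c *\<^sub>C x) = 0"
    by (simp add: cinner_scaleC_left)
  then have *: "cinner (y - c *\<^sub>C x) (c *\<^sub>C x) = 0"
    by (simp add: cinner_commute[of "y - _" "c *\<^sub>C x"])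
  have "(norm y)\<^sup>2 = (norm (y - c *\<^sub>C x - (- (c *\<^sub>C x))))\<^sup>2" by simp
  also have "\<dots> = (norm (y - c *\<^sub>C x))\<^sup>2 + (norm (c *\<^sub>C x))\<^sup>2"
    using * by (subst norm_sq_diff) (simp add: cinner_minus_right)
  finally have "(norm (c *\<^sub>C x))\<^sup>2 \<le> (norm y)\<^sup>2" by simp
  then have "cmod c * norm x \<le> norm y" by (simp add: norm_scaleC)
  then have "norm x * (cmod c * norm x) \<le> norm x * norm y" by (rule mult_left_mono) simp
  moreover have "norm x * (cmod c * norm x) = cmod (cinner x y)"
    using False by (simp add: c_def norm_divide norm_mult power2_eq_square)
  ultimately show ?thesis by simp
qed simp

lemma tendsto_cinner_right:
  assumes "X \<longlonglongrightarrow> (x :: 'a::complex_inner)"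
  shows "(\<lambda>k. cinner y (X k)) \<longlonglongrightarrow> cinner y x"
proof -
  have "(\<lambda>k. norm y * norm (X k - x)) \<longlonglongrightarrow> norm y * 0"
    using assms by (intro tendsto_mult_left) (simp add: LIM_zero_iff tendsto_norm_zero)
  moreover have "cmod (cinner y (X k) - cinner y x) \<le> norm y * norm (X k - x)" for k
    by (metis Cauchy_Schwarz_cinner cinner_diff_right)
  ultimately have "(\<lambda>k. cinner y (X k) - cinner y x) \<longlonglongrightarrow> 0"
    by (auto intro: Lim_null_comparison[where g = "\<lambda>k. norm y * norm (X k - x)"])
  then show ?thesis by (simp add: LIM_zero_iff)
qed

lemma tendsto_cinner_left:
  assumes "X \<longlonglongrightarrow> (x :: 'a::complex_inner)"
  shows "(\<lambda>k. cinner (X k) y) \<longlonglongrightarrow> cinner x y"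
  using tendsto_cnj[OF tendsto_cinner_right[OF assms, of y]] by (simp only: cinner_commute[of _ y] complex_cnj_cnj)

lemma dense_cinner_eq:
  assumes "closure D = (UNIV :: 'a::complex_inner set)"
    and "\<And>x. x \<in> D \<Longrightarrow> cinner w x = cinner w' x"
  shows "w = w'"
proof -
  obtain X where X: "\<And>k. X k \<in> D" "X \<longlonglongrightarrow> w - w'"
    using assms(1) closure_sequential[of "w - w'" D] by auto
  have "(\<lambda>k. cinner (w - w') (X k)) \<longlonglongrightarrow> cinner (w - w') (w - w')"
    by (rule tendsto_cinner_right[OF X(2)])
  moreover have "cinner (w - w') (X k) = 0" for k
    using assms(2)[OF X(1)] by (simp add: cinner_diff_left)
  ultimately have "cinner (w - w') (w - w') = 0"
    by (simp add: LIMSEQ_const_iff)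
  then show ?thesis by (simp add: norm_cinner)
qed

section \<open>Basic properties of self-adjoint operators\<close>

text \<open>
  The domain of the adjoint is no larger than D: a vector that pairs with the range of M like an
  element of D is one. Symmetry and closedness of M both follow from this.
\<close>

lemma self_adjoint_maximal:
  assumes "self_adjoint D M" and "\<And>x. x \<in> D \<Longrightarrow> cinner y (M x) = cinner w x"
  shows "y \<in> D" and "M y = w"
proof -
  have cl: "closure D = UNIV" and "adj_dom D M = D" and adj: "\<And>x. x \<in> D \<Longrightarrow> adj D M x = M x"
    using assms(1) by (auto simp: self_adjoint_def)
  moreover have "y \<in> adj_dom D M" unfolding adj_dom_def using assms(2) by blast
  ultimately show y: "y \<in> D" by simp
  have "adj D M y = w"
    unfolding adj_def using assms(2) dense_cinner_eq[OF cl]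
    by (intro the_equality) metis+
  then show "M y = w" using adj[OF y] by simp
qed

lemma self_adjoint_symmetric:
  assumes "self_adjoint D M" and "x \<in> D" and "y \<in> D"
  shows "cinner (M y) x = cinner y (M x)"
proof -
  have "y \<in> adj_dom D M" using assms by (simp add: self_adjoint_def)
  then obtain w where w: "\<And>x. x \<in> D \<Longrightarrow> cinner y (M x) = cinner w x"
    by (auto simp: adj_dom_def)
  with self_adjoint_maximal(2)[OF assms(1) w] assms show ?thesis by simp
qed

lemma self_adjoint_closed:
  assumes "self_adjoint D M" and "\<And>k. X k \<in> D" and "X \<longlonglongrightarrow> x" and "(\<lambda>k. M (X k)) \<longlonglongrightarrow> y"
  shows "x \<in> D" and "M x = y"
proof -
  have "cinner x (M u) = cinner y u" if "u \<in> D" for u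
  proof -
    have "(\<lambda>k. cinner (M (X k)) u) \<longlonglongrightarrow> cinner y u"
      by (rule tendsto_cinner_left[OF assms(4)])
    moreover have "(\<lambda>k. cinner (M (X k)) u) \<longlonglongrightarrow> cinner x (M u)"
      using tendsto_cinner_left[OF assms(3)]
      by (simp add: self_adjoint_symmetric[OF assms(1) that assms(2)])
    ultimately show ?thesis by (rule LIMSEQ_unique[symmetric])
  qed
  from self_adjoint_maximal[OF assms(1) this] show "x \<in> D" "M x = y" by auto
qed

lemma self_adjoint_eigenvalue_real:
  assumes "self_adjoint D M" and "\<psi> \<in> eigenspace D M z" and "\<psi> \<noteq> 0"
  shows "cnj z = z"
  using self_adjoint_symmetric[OF assms(1), of \<psi> \<psi>] assms(2,3)
  by (simp add: eigenspace_def cinner_scaleC_left cinner_scaleC_right norm_cinner)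

text \<open>
  A real shift moves the eigenvalue under study to 0, so that the estimates below concern the kernel of
  a self-adjoint operator.
\<close>

lemma self_adjoint_shift:
  assumes "self_adjoint D M" and "cnj c = c"
  shows "self_adjoint D (\<lambda>x. M x - c *\<^sub>C x)"
proof -
  let ?N = "\<lambda>x. M x - c *\<^sub>C x"
  have opM: "operator_on D M" using assms(1) by (simp add: self_adjoint_def)
  have "?N (x + y) = ?N x + ?N y" if "x \<in> D" "y \<in> D" for x y
    using opM that unfolding operator_on_def by (metis add_diff_add scaleC_add_right)
  moreover have "?N (a *\<^sub>C x) = a *\<^sub>C ?N x" if "x \<in> D" for a x
    using opM that unfolding operator_on_def
    by (metis complex_vector.scale_right_diff_distrib complex_vector.scale_left_commute)
  ultimately have op: "operator_on D ?N" using opM unfolding operator_on_def by blast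
  have cl: "closure D = UNIV" using assms(1) by (auto simp: self_adjoint_def)
  have sym: "cinner y (?N x) = cinner (?N y) x" if "x \<in> D" "y \<in> D" for x y
    using self_adjoint_symmetric[OF assms(1) that] assms(2)
    by (simp add: cinner_diff_right cinner_diff_left cinner_scaleC_left cinner_scaleC_right)
  have max: "y \<in> D \<and> ?N y = w" if "\<And>x. x \<in> D \<Longrightarrow> cinner y (?N x) = cinner w x" for y w
  proof -
    have "cinner y (M x) = cinner (w + c *\<^sub>C y) x" if "x \<in> D" for x
      using \<open>\<And>x. x \<in> D \<Longrightarrow> cinner y (?N x) = cinner w x\<close>[OF that] assms(2)
      by (simp add: cinner_diff_right cinner_add_left cinner_scaleC_left cinner_scaleC_right algebra_simps)
    from self_adjoint_maximal[OF assms(1) this] show ?thesis by simp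
  qed
  have "adj_dom D ?N = D" unfolding adj_dom_def using max sym by blast
  moreover have "adj D ?N x = ?N x" if x: "x \<in> D" for x
    unfolding adj_def
  proof (rule the_equality)
    show "\<forall>u\<in>D. cinner x (?N u) = cinner (?N x) u" using sym x by blast
    show "w = ?N x" if "\<forall>u\<in>D. cinner x (?N u) = cinner w u" for w
      using max[of x w] that by blast
  qed
  ultimately show ?thesis using op cl by (simp add: self_adjoint_def)
qed

section \<open>The spectral gap at an isolated eigenvalue\<close>

lemma scaleC_of_real: "complex_of_real r *\<^sub>C x = r *\<^sub>R (x :: 'a::complex_inner)"
  by (simp add: scaleR_scaleC)

text \<open>
  For a bounded symmetric A of norm K, one of K and -K is an approximate eigenvalue. Indeed, if A - K
  and A + K are both bounded below then so is their product A^2 - K^2; but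
  \<open>\<parallel>(A\<^sup>2 - K\<^sup>2) x\<parallel>\<^sup>2 \<le> K\<^sup>2 (K\<^sup>2 \<parallel>x\<parallel>\<^sup>2 - \<parallel>A x\<parallel>\<^sup>2)\<close>, so a lower bound here forces \<open>\<parallel>A x\<parallel>\<close> to stay away
  from \<open>K \<parallel>x\<parallel>\<close>, contradicting the definition of the norm. So A is bounded by s as soon as
  no real c with modulus above s is an approximate eigenvalue.
\<close>

lemma symmetric_norm_bound:
  fixes A :: "'a::complex_inner \<Rightarrow> 'a"
  assumes A: "bounded_linear A" and sym: "\<And>x y. cinner (A x) y = cinner x (A y)"
    and s: "s \<ge> 0"
    and below: "\<And>c. \<bar>c\<bar> > s \<Longrightarrow> \<exists>\<kappa>>0. \<forall>x. \<kappa> * norm x \<le> norm (A x - c *\<^sub>R x)"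
  shows "norm (A x) \<le> s * norm x"
proof -
  interpret A: bounded_linear A by fact
  define K where "K = onorm A"
  have K: "norm (A x) \<le> K * norm x" for x
    unfolding K_def by (rule onorm[OF A])
  have "K \<le> s"
  proof (rule ccontr)
    assume "\<not> K \<le> s"
    then have Ks: "K > s" by simp
    with s have K0: "K > 0" by simp
    obtain \<kappa>1 where \<kappa>1: "\<kappa>1 > 0" "\<And>x. \<kappa>1 * norm x \<le> norm (A x - K *\<^sub>R x)"
      using below[of K] Ks s by auto
    obtain \<kappa>2 where \<kappa>2: "\<kappa>2 > 0" "\<And>x. \<kappa>2 * norm x \<le> norm (A x - (- K) *\<^sub>R x)"
      using below[of "- K"] Ks s by auto
    define \<kappa> where "\<kappa> = \<kappa>1 * \<kappa>2"
    have \<kappa>: "\<kappa> > 0" using \<kappa>1 \<kappa>2 by (simp add: \<kappa>_def)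
    have up: "(norm (A x))\<^sup>2 \<le> (K\<^sup>2 - \<kappa>\<^sup>2 / K\<^sup>2) * (norm x)\<^sup>2" for x
    proof -
      have fact: "A (A x - (- K) *\<^sub>R x) - K *\<^sub>R (A x - (- K) *\<^sub>R x) = A (A x) - K\<^sup>2 *\<^sub>R x"
        by (simp add: A.add A.scaleR scaleR_add_right power2_eq_square)
      have "\<kappa> * norm x \<le> \<kappa>1 * norm (A x - (- K) *\<^sub>R x)"
        using mult_left_mono[OF \<kappa>2(2)[of x], of \<kappa>1] \<kappa>1(1) by (simp add: \<kappa>_def mult.assoc)
      also have "\<dots> \<le> norm (A (A x) - K\<^sup>2 *\<^sub>R x)"
        using \<kappa>1(2)[of "A x - (- K) *\<^sub>R x"] unfolding fact .
      finally have "(\<kappa> * norm x)\<^sup>2 \<le> (norm (A (A x) - K\<^sup>2 *\<^sub>R x))\<^sup>2"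
        using \<kappa> by (intro power_mono) auto
      also have "\<dots> = (norm (A (A x)))\<^sup>2 - 2 * (K\<^sup>2 * (norm (A x))\<^sup>2) + (K\<^sup>2 * norm x)\<^sup>2"
        unfolding norm_sq_diff
        by (simp add: scaleR_scaleC cinner_scaleC_right sym norm_cinner norm_scaleC norm_power
            del: of_real_power flip: of_real_mult)
      also have "(norm (A (A x)))\<^sup>2 \<le> (K * norm (A x))\<^sup>2"
        by (intro power_mono K) auto
      finally have "\<kappa>\<^sup>2 * (norm x)\<^sup>2 \<le> K\<^sup>2 * (K\<^sup>2 * (norm x)\<^sup>2 - (norm (A x))\<^sup>2)"
        by (simp add: power_mult_distrib algebra_simps power2_eq_square)
      then have "\<kappa>\<^sup>2 * (norm x)\<^sup>2 / K\<^sup>2 \<le> K\<^sup>2 * (norm x)\<^sup>2 - (norm (A x))\<^sup>2"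
        using K0 by (simp add: field_simps)
      then show ?thesis by (simp add: algebra_simps)
    qed
    define K' where "K' = sqrt (max 0 (K\<^sup>2 - \<kappa>\<^sup>2 / K\<^sup>2))"
    have "norm (A x) \<le> K' * norm x" for x
    proof -
      have "(norm (A x))\<^sup>2 \<le> max 0 (K\<^sup>2 - \<kappa>\<^sup>2 / K\<^sup>2) * (norm x)\<^sup>2"
        using up[of x] by (rule order_trans) (intro mult_right_mono, auto)
      then have "(norm (A x))\<^sup>2 \<le> (K' * norm x)\<^sup>2"
        by (simp add: K'_def power_mult_distrib)
      then show ?thesis
        by (rule power2_le_imp_le) (simp add: K'_def)
    qed
    then have "K \<le> K'" unfolding K_def by (intro onorm_bound) (auto simp: K'_def)
    moreover have "K' < sqrt (K\<^sup>2)"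
      unfolding K'_def using K0 \<kappa> by (intro real_sqrt_less_mono) auto
    ultimately show False using K0 by simp
  qed
  then show ?thesis
    by (meson K mult_right_mono norm_ge_zero order_trans)
qed

text \<open>
  The inverse of \<open>N\<^sup>2 - \<tau>\<^sup>2\<close> comes from the factorization \<open>N\<^sup>2 - \<tau>\<^sup>2 = (- \<tau> - N) (\<tau> - N)\<close>.
\<close>

lemma square_resolvent:
  fixes N :: "'a::complex_inner \<Rightarrow> 'a"
  assumes N: "operator_on D N"
    and res: "complex_of_real \<tau> \<in> resolvent_set D N" "- complex_of_real \<tau> \<in> resolvent_set D N"
  obtains A where "bounded_linear A" "\<And>y. A y \<in> dom_square D N"
    "\<And>y. N (N (A y)) - (\<tau>\<^sup>2) *\<^sub>R A y = y"
    "\<And>w. w \<in> dom_square D N \<Longrightarrow> A (N (N w) - (\<tau>\<^sup>2) *\<^sub>R w) = w"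
proof -
  have sD: "complex_vector.subspace D"
    and add: "\<And>x y. x \<in> D \<Longrightarrow> y \<in> D \<Longrightarrow> N (x + y) = N x + N y"
    and scale: "\<And>a x. x \<in> D \<Longrightarrow> N (a *\<^sub>C x) = a *\<^sub>C N x"
    using N by (auto simp: operator_on_def)
  have diff: "N (x - y) = N x - N y" if "x \<in> D" "y \<in> D" for x y
    using add[of "x - y" y] complex_vector.subspace_diff[OF sD] that by simp
  have scR: "r *\<^sub>R x \<in> D \<and> N (r *\<^sub>R x) = r *\<^sub>R N x" if "x \<in> D" for r x
    using scale[OF that] complex_vector.subspace_scale[OF sD that] by (simp add: scaleR_scaleC)
  obtain R1 where R1: "bounded_linear R1" "\<And>y. R1 y \<in> D"
    "\<And>y. \<tau> *\<^sub>R R1 y - N (R1 y) = y" "\<And>x. x \<in> D \<Longrightarrow> R1 (\<tau> *\<^sub>R x - N x) = x"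
    using res(1) by (auto simp: resolvent_set_def shifted_def scaleC_of_real)
  obtain R2 where R2: "bounded_linear R2" "\<And>y. R2 y \<in> D"
    "\<And>y. (- \<tau>) *\<^sub>R R2 y - N (R2 y) = y" "\<And>x. x \<in> D \<Longrightarrow> R2 ((- \<tau>) *\<^sub>R x - N x) = x"
    using res(2) by (auto simp: resolvent_set_def shifted_def scaleC_of_real simp flip: of_real_minus)
  have fac: "(- \<tau>) *\<^sub>R (\<tau> *\<^sub>R w - N w) - N (\<tau> *\<^sub>R w - N w) = N (N w) - (\<tau>\<^sup>2) *\<^sub>R w"
    if "w \<in> dom_square D N" for w
    using that scR[of w \<tau>] diff[of "\<tau> *\<^sub>R w" "N w"]
    by (auto simp: dom_square_def scaleR_diff_right power2_eq_square)
  have inD: "R1 (R2 y) \<in> dom_square D N" for y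
  proof -
    have "N (R1 (R2 y)) = \<tau> *\<^sub>R R1 (R2 y) - R2 y"
      using R1(3)[of "R2 y"] by (simp add: algebra_simps)
    then show ?thesis
      using R1(2) R2(2) scR complex_vector.subspace_diff[OF sD] by (auto simp: dom_square_def)
  qed
  show thesis
  proof
    show "bounded_linear (\<lambda>y. R1 (R2 y))"
      by (rule bounded_linear_compose[OF R1(1) R2(1)])
    show "R1 (R2 y) \<in> dom_square D N" for y by fact
    show "N (N (R1 (R2 y))) - (\<tau>\<^sup>2) *\<^sub>R R1 (R2 y) = y" for y
      using fac[OF inD, of y] R1(3)[of "R2 y"] R2(3)[of y] by simp
    show "R1 (R2 (N (N w) - (\<tau>\<^sup>2) *\<^sub>R w)) = w" if w: "w \<in> dom_square D N" for w
    proof -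
      have "\<tau> *\<^sub>R w - N w \<in> D"
        using w scR complex_vector.subspace_diff[OF sD] by (auto simp: dom_square_def)
      then have "R2 (N (N w) - (\<tau>\<^sup>2) *\<^sub>R w) = \<tau> *\<^sub>R w - N w"
        using R2(4) fac[OF w] by metis
      then show ?thesis using R1(4) w by (auto simp: dom_square_def)
    qed
  qed
qed

text \<open>
  If the punctured disc of radius \<open>\<epsilon>\<close> contains no spectrum of N then the positive operator \<open>N\<^sup>2\<close> has no spectrum in
  \<open>(0, \<epsilon>\<^sup>2)\<close>. As \<open>\<sigma>\<^sup>2\<close> lies in the lower half of this gap, 0 is the closest spectral point that
  may exist, and \<open>N\<^sup>2 - \<sigma>\<^sup>2\<close> has an inverse of norm at most \<open>1 / \<sigma>\<^sup>2\<close>. Expanding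
  \<open>\<sigma>\<^sup>4 \<parallel>w\<parallel>\<^sup>2 \<le> \<parallel>(N\<^sup>2 - \<sigma>\<^sup>2) w\<parallel>\<^sup>2\<close>, the terms in \<open>\<parallel>w\<parallel>\<^sup>2\<close> cancel and the claim remains: N is bounded
  below on those vectors N w that lie in its domain.
\<close>

lemma square_lower_bound:
  fixes N :: "'a::chilbert_space \<Rightarrow> 'a"
  assumes sa: "self_adjoint D N"
    and res: "\<And>\<zeta>. \<zeta> \<noteq> 0 \<Longrightarrow> cmod \<zeta> < \<epsilon> \<Longrightarrow> \<zeta> \<in> resolvent_set D N"
    and \<sigma>: "\<sigma> > 0" "2 * \<sigma>\<^sup>2 < \<epsilon>\<^sup>2" and \<epsilon>: "\<epsilon> > 0"
    and w: "w \<in> dom_square D N"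
  shows "sqrt 2 * \<sigma> * norm (N w) \<le> norm (N (N w))"
proof -
  have N: "operator_on D N" using sa by (simp add: self_adjoint_def)
  note sym = self_adjoint_symmetric[OF sa]
  have sqres: "\<exists>A. bounded_linear A \<and> (\<forall>y. A y \<in> dom_square D N \<and> N (N (A y)) - (\<tau>\<^sup>2) *\<^sub>R A y = y) \<and>
     (\<forall>w\<in>dom_square D N. A (N (N w) - (\<tau>\<^sup>2) *\<^sub>R w) = w)" if "0 < \<tau>" "\<tau>\<^sup>2 < \<epsilon>\<^sup>2" for \<tau>
  proof -
    have "\<tau> < \<epsilon>" using that \<epsilon> by (simp add: power_less_imp_less_base)
    then have "complex_of_real \<tau> \<in> resolvent_set D N" "- complex_of_real \<tau> \<in> resolvent_set D N"
      using that by (auto intro!: res)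
    then show ?thesis by (metis square_resolvent[OF N])
  qed
  have s1: "\<sigma>\<^sup>2 < \<epsilon>\<^sup>2" using \<sigma> zero_less_power[of \<sigma> 2] by linarith
  obtain A where A: "bounded_linear A" "\<And>y. A y \<in> dom_square D N"
    "\<And>y. N (N (A y)) - (\<sigma>\<^sup>2) *\<^sub>R A y = y"
    "\<And>w. w \<in> dom_square D N \<Longrightarrow> A (N (N w) - (\<sigma>\<^sup>2) *\<^sub>R w) = w"
    using sqres[OF \<sigma>(1) s1] by blast
  have Asym: "cinner (A x) y = cinner x (A y)" for x y
  proof -
    have d: "A x \<in> D" "N (A x) \<in> D" "A y \<in> D" "N (A y) \<in> D"
      using A(2) by (auto simp: dom_square_def)
    have "cinner (A x) y = cinner (A x) (N (N (A y)) - (\<sigma>\<^sup>2) *\<^sub>R A y)" by (simp add: A(3))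
    also have "\<dots> = cinner (N (N (A x)) - (\<sigma>\<^sup>2) *\<^sub>R A x) (A y)"
      using d by (simp add: sym cinner_diff_left cinner_diff_right scaleR_scaleC
          cinner_scaleC_left cinner_scaleC_right)
    finally show ?thesis by (simp add: A(3))
  qed
  have bound: "norm (A x) \<le> (1 / \<sigma>\<^sup>2) * norm x" for x
  proof (rule symmetric_norm_bound[OF A(1) Asym])
    fix c :: real assume c: "\<bar>c\<bar> > 1 / \<sigma>\<^sup>2"
    then have c0: "c \<noteq> 0" using \<sigma>(1) by auto
    \<comment> \<open>With \<open>A = (N\<^sup>2 - \<sigma>\<^sup>2)\<^sup>-\<^sup>1\<close>, the operator A - c is singular exactly when \<open>N\<^sup>2 - \<tau>\<^sup>2\<close> is.\<close>
    define \<tau> where "\<tau> = sqrt (\<sigma>\<^sup>2 + 1 / c)"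
    have "\<bar>1 / c\<bar> < \<sigma>\<^sup>2" using c c0 \<sigma>(1) by (simp add: abs_divide field_simps)
    then have "0 < \<sigma>\<^sup>2 + 1 / c" "\<sigma>\<^sup>2 + 1 / c < \<epsilon>\<^sup>2"
      using \<sigma>(2) unfolding abs_less_iff by linarith+
    then have \<tau>2: "\<tau>\<^sup>2 = \<sigma>\<^sup>2 + 1 / c" and \<tau>: "0 < \<tau>" "\<tau>\<^sup>2 < \<epsilon>\<^sup>2"
      by (auto simp: \<tau>_def)
    obtain B where B: "bounded_linear B"
      "\<And>w. w \<in> dom_square D N \<Longrightarrow> B (N (N w) - (\<tau>\<^sup>2) *\<^sub>R w) = w"
      using sqres[OF \<tau>] by blast
    obtain K where K: "K > 0" "\<And>y. norm (B y) \<le> norm y * K"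
      using bounded_linear.pos_bounded[OF B(1)] by auto
    show "\<exists>\<kappa>>0. \<forall>x. \<kappa> * norm x \<le> norm (A x - c *\<^sub>R x)"
    proof (intro exI conjI allI)
      show "0 < \<bar>c\<bar> / (1 + K / \<bar>c\<bar>)" using c0 K(1) by (simp add: divide_pos_pos add_pos_pos)
      fix x
      define w where "w = A x"
      have x: "x = N (N w) - (\<sigma>\<^sup>2) *\<^sub>R w" by (simp add: w_def A(3))
      have "(- c) *\<^sub>R (N (N w) - (\<tau>\<^sup>2) *\<^sub>R w) = w - c *\<^sub>R (N (N w) - (\<sigma>\<^sup>2) *\<^sub>R w)"
        using c0 by (simp add: \<tau>2 scaleR_diff_right scaleR_add_left scaleR_add_right distrib_left)
      then have eq: "A x - c *\<^sub>R x = (- c) *\<^sub>R (N (N w) - (\<tau>\<^sup>2) *\<^sub>R w)"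
        by (simp only: x[symmetric]) (simp only: w_def)
      have "norm w = norm (B (N (N w) - (\<tau>\<^sup>2) *\<^sub>R w))" using A(2) by (simp add: B(2) w_def)
      also have "\<dots> \<le> norm (N (N w) - (\<tau>\<^sup>2) *\<^sub>R w) * K" by (rule K(2))
      also have "\<dots> = norm (A x - c *\<^sub>R x) * (K / \<bar>c\<bar>)" using c0 by (simp add: eq)
      finally have "norm (A x) \<le> norm (A x - c *\<^sub>R x) * (K / \<bar>c\<bar>)" by (simp add: w_def)
      moreover have "\<bar>c\<bar> * norm x \<le> norm (A x) + norm (A x - c *\<^sub>R x)"
        using norm_triangle_sub[of "c *\<^sub>R x" "A x"] by (simp add: norm_minus_commute)
      ultimately have "\<bar>c\<bar> * norm x \<le> norm (A x - c *\<^sub>R x) * (1 + K / \<bar>c\<bar>)"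
        by (simp add: distrib_left)
      then show "\<bar>c\<bar> / (1 + K / \<bar>c\<bar>) * norm x \<le> norm (A x - c *\<^sub>R x)"
        using c0 K(1) by (simp add: pos_divide_le_eq add_pos_pos)
    qed
  qed simp
  have d: "w \<in> D" "N w \<in> D" using w by (auto simp: dom_square_def)
  have "norm w \<le> (1 / \<sigma>\<^sup>2) * norm (N (N w) - (\<sigma>\<^sup>2) *\<^sub>R w)"
    using bound[of "N (N w) - (\<sigma>\<^sup>2) *\<^sub>R w"] A(4)[OF w] by simp
  then have "\<sigma>\<^sup>2 * norm w \<le> norm (N (N w) - (\<sigma>\<^sup>2) *\<^sub>R w)"
    using \<sigma>(1) by (simp add: field_simps)
  then have "(\<sigma>\<^sup>2 * norm w)\<^sup>2 \<le> (norm (N (N w) - (\<sigma>\<^sup>2) *\<^sub>R w))\<^sup>2"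
    by (intro power_mono) auto
  also have "\<dots> = (norm (N (N w)))\<^sup>2 - 2 * (\<sigma>\<^sup>2 * (norm (N w))\<^sup>2) + (\<sigma>\<^sup>2 * norm w)\<^sup>2"
    unfolding norm_sq_diff
    using d by (simp add: scaleR_scaleC cinner_scaleC_right sym norm_cinner norm_scaleC norm_power
            del: of_real_power flip: of_real_mult)
  finally have "(sqrt 2 * \<sigma> * norm (N w))\<^sup>2 \<le> (norm (N (N w)))\<^sup>2"
    by (simp add: power_mult_distrib)
  then show ?thesis by (rule power2_le_imp_le) simp
qed

text \<open>
  If 0 is at most an isolated point of the spectrum, N is bounded below transversally to its kernel. For u in the domain put \<open>p = \<i> y (\<i> y - N)\<^sup>-\<^sup>1 u\<close> with small y > 0. The
  vectors u - p, and therefore all differences of such p, have the form N w, where the lower bound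
  for \<open>N\<^sup>2\<close> is available; and N p tends to 0 with y. So the p form a Cauchy sequence, whose limit q
  is the component of u in the kernel.
\<close>

lemma isolated_spectral_gap:
  fixes N :: "'a::chilbert_space \<Rightarrow> 'a"
  assumes sa: "self_adjoint D N"
    and \<epsilon>: "\<epsilon> > 0"
    and res: "\<And>\<zeta>. \<zeta> \<noteq> 0 \<Longrightarrow> cmod \<zeta> < \<epsilon> \<Longrightarrow> \<zeta> \<in> resolvent_set D N"
  obtains \<beta> where "\<beta> > 0"
    "\<And>u. u \<in> D \<Longrightarrow> \<exists>q\<in>D. N q = 0 \<and> norm q \<le> norm u \<and> \<beta> * norm (u - q) \<le> norm (N u)"
proof -
  have N: "operator_on D N" using sa by (simp add: self_adjoint_def)
  note sym = self_adjoint_symmetric[OF sa]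
  have sD: "complex_vector.subspace D"
    and add: "\<And>x y. x \<in> D \<Longrightarrow> y \<in> D \<Longrightarrow> N (x + y) = N x + N y"
    and scale: "\<And>a x. x \<in> D \<Longrightarrow> N (a *\<^sub>C x) = a *\<^sub>C N x"
    using N by (auto simp: operator_on_def)
  have diff: "N (x - y) = N x - N y" if "x \<in> D" "y \<in> D" for x y
    using add[of "x - y" y] complex_vector.subspace_diff[OF sD] that by simp
  define \<beta> where "\<beta> = sqrt 2 * (\<epsilon> / 2)"
  have \<beta>: "\<beta> > 0" using \<epsilon> by (simp add: \<beta>_def)
  have low: "\<beta> * norm (N w) \<le> norm (N (N w))" if "w \<in> D" "N w \<in> D" for w
    unfolding \<beta>_def using \<epsilon> that
    by (intro square_lower_bound[OF sa res _ _ \<epsilon>]) (auto simp: dom_square_def power2_eq_square)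
  show thesis
  proof (rule that[OF \<beta>])
    fix u assume u: "u \<in> D"
    define y where "y = (\<lambda>k::nat. \<epsilon> / (real k + 2))"
    have y: "0 < y k" "y k < \<epsilon>" for k
      using \<epsilon> mult_nonneg_nonneg[of \<epsilon> "real k"] by (auto simp: y_def field_simps intro: add_pos_nonneg)
    have y0: "y \<longlonglongrightarrow> 0" unfolding y_def by real_asymp
    have "\<exists>r. r \<in> D \<and> (\<i> * y k) *\<^sub>C r - N r = u" for k
    proof -
      have "\<i> * y k \<in> resolvent_set D N" using y[of k] by (intro res) (auto simp: norm_mult)
      then show ?thesis by (auto simp: resolvent_set_def shifted_def)
    qed
    then obtain r where r: "\<And>k. r k \<in> D" "\<And>k. (\<i> * y k) *\<^sub>C r k - N (r k) = u" by metis
    define p where "p = (\<lambda>k. (\<i> * y k) *\<^sub>C r k)"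
    have pD: "p k \<in> D" for k using r(1) sD by (simp add: p_def complex_vector.subspace_scale)
    have pu: "p k - u = N (r k)" for k using r(2)[of k] by (simp add: p_def algebra_simps)
    have NrD: "N (r k) \<in> D" for k
      using complex_vector.subspace_diff[OF sD pD u] pu by metis
    have Np: "N (p k) = (\<i> * y k) *\<^sub>C N (r k)" for k unfolding p_def by (rule scale[OF r(1)])
    \<comment> \<open>As \<open>\<langle>r, N r\<rangle>\<close> is real, \<open>\<i> y r\<close> and N r are orthogonal for the real part of the inner product.\<close>
    have sum: "(norm u)\<^sup>2 = (norm (p k))\<^sup>2 + (norm (N (r k)))\<^sup>2" for k
    proof -
      have "cnj (cinner (r k) (N (r k))) = cinner (r k) (N (r k))"
        using sym[OF r(1) r(1), of k k] by (metis cinner_commute)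
      then have "Im (cinner (r k) (N (r k))) = 0" by (simp add: complex_eq_iff)
      then have "Re (cinner (p k) (N (r k))) = 0"
        by (simp add: p_def cinner_scaleC_left)
      moreover have "u = p k - N (r k)" using pu[of k] by (simp add: algebra_simps)
      ultimately show ?thesis by (simp add: norm_sq_diff)
    qed
    have pn: "norm (p k) \<le> norm u" for k
      using sum[of k] by (auto intro: power2_le_imp_le[OF _ norm_ge_zero])
    have rn: "norm (N (r k)) \<le> norm u" for k
      using sum[of k] by (auto intro: power2_le_imp_le[OF _ norm_ge_zero])
    have Npn: "norm (N (p k)) \<le> y k * norm u" for k
      unfolding Np using mult_left_mono[OF rn[of k], of "y k"] y(1)[of k]
      by (simp add: norm_scaleC norm_mult)
    have Np0: "(\<lambda>k. N (p k)) \<longlonglongrightarrow> 0"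
    proof (rule Lim_null_comparison)
      show "\<forall>\<^sub>F k in sequentially. norm (N (p k)) \<le> y k * norm u" using Npn by simp
      show "(\<lambda>k. y k * norm u) \<longlonglongrightarrow> 0" using tendsto_mult_right[OF y0, of "norm u"] by simp
    qed
    have pdiff: "\<beta> * norm (p k - p l) \<le> norm (N (p k)) + norm (N (p l))" for k l
    proof -
      have e: "p k - p l = N (r k - r l)"
        by (simp only: diff[OF r(1) r(1)] pu[symmetric]) simp
      have "\<beta> * norm (N (r k - r l)) \<le> norm (N (N (r k - r l)))"
        using r(1) NrD by (intro low) (auto simp: diff complex_vector.subspace_diff[OF sD])
      also have "N (N (r k - r l)) = N (p k) - N (p l)" by (simp only: e[symmetric] diff[OF pD pD])
      also have "norm \<dots> \<le> norm (N (p k)) + norm (N (p l))" by (rule norm_triangle_ineq4)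
      finally show ?thesis by (simp only: e)
    qed
    have "Cauchy p"
    proof (rule metric_CauchyI)
      fix e :: real assume e: "e > 0"
      have "\<forall>\<^sub>F k in sequentially. norm (N (p k)) < \<beta> * e / 2"
        using Np0 \<beta> e by (intro order_tendstoD(2)[OF tendsto_norm_zero[OF Np0]]) auto
      then obtain K where K: "\<And>k. k \<ge> K \<Longrightarrow> norm (N (p k)) < \<beta> * e / 2"
        by (auto simp: eventually_sequentially)
      have "dist (p k) (p l) < e" if "k \<ge> K" "l \<ge> K" for k l
      proof -
        have "\<beta> * norm (p k - p l) < \<beta> * e" using pdiff[of k l] K[OF that(1)] K[OF that(2)] by linarith
        then show ?thesis using \<beta> by (simp add: dist_norm)
      qed
      then show "\<exists>K. \<forall>k\<ge>K. \<forall>l\<ge>K. dist (p k) (p l) < e" by blast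
    qed
    then obtain q where q: "p \<longlonglongrightarrow> q" using Cauchy_convergent convergentD by blast
    have "q \<in> D" "N q = 0" using self_adjoint_closed[OF sa pD q Np0] by auto
    moreover have "norm q \<le> norm u"
      by (rule LIMSEQ_le_const2[OF tendsto_norm[OF q]]) (use pn in auto)
    moreover have "\<beta> * norm (u - q) \<le> norm (N u)"
    proof (rule LIMSEQ_le)
      show "(\<lambda>k. \<beta> * norm (u - p k)) \<longlonglongrightarrow> \<beta> * norm (u - q)"
        by (intro tendsto_intros q)
      show "(\<lambda>k. norm (N (p k)) + norm (N u)) \<longlonglongrightarrow> norm (N u)"
        using tendsto_add[OF tendsto_norm_zero[OF Np0] tendsto_const[of "norm (N u)"]] by simp
      have "\<beta> * norm (u - p k) \<le> norm (N (p k)) + norm (N u)" for k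
      proof -
        have "\<beta> * norm (N (r k)) \<le> norm (N (p k - u))" using low[OF r(1) NrD, of k] by (simp add: pu)
        also have "\<dots> \<le> norm (N (p k)) + norm (N u)"
          unfolding diff[OF pD u] by (rule norm_triangle_ineq4)
        finally show ?thesis by (simp add: pu[symmetric] norm_minus_commute)
      qed
      then show "\<exists>K. \<forall>k\<ge>K. \<beta> * norm (u - p k) \<le> norm (N (p k)) + norm (N u)" by blast
    qed
    ultimately show "\<exists>q\<in>D. N q = 0 \<and> norm q \<le> norm u \<and> \<beta> * norm (u - q) \<le> norm (N u)" by blast
  qed
qed

section \<open>Determinants of holomorphic operator families\<close>

lemma holomorphic_on_det:
  fixes F :: "complex \<Rightarrow> nat \<Rightarrow> nat \<Rightarrow> complex"
  assumes "\<And>i j. i < n \<Longrightarrow> j < n \<Longrightarrow> (\<lambda>z. F z i j) holomorphic_on S"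
  shows "(\<lambda>z. Determinant.det (Matrix.mat n n (\<lambda>(i, j). F z i j))) holomorphic_on S"
proof -
  have "(\<lambda>z. \<Sum>p | p permutes {0..<n}. signof p * (\<Prod>i = 0..<n. F z i (p i))) holomorphic_on S"
    using assms by (intro holomorphic_intros) (auto simp: permutes_in_image)
  also have "(\<lambda>z. \<Sum>p | p permutes {0..<n}. signof p * (\<Prod>i = 0..<n. F z i (p i))) =
      (\<lambda>z. Determinant.det (Matrix.mat n n (\<lambda>(i, j). F z i j)))"
    by (auto simp: Determinant.det_def permutes_in_image intro!: ext sum.cong prod.cong)
  finally show ?thesis .
qed

lemma holomorphic_on_adj_mat:
  fixes F :: "complex \<Rightarrow> nat \<Rightarrow> nat \<Rightarrow> complex"
  assumes F: "\<And>i j. i < n \<Longrightarrow> j < n \<Longrightarrow> (\<lambda>z. F z i j) holomorphic_on S"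
    and ij: "i < n" "j < n"
  shows "(\<lambda>z. adj_mat (Matrix.mat n n (\<lambda>(i, j). F z i j)) $$ (i, j)) holomorphic_on S"
proof -
  have "mat_delete (Matrix.mat n n (\<lambda>(i, j). F z i j)) j i =
      Matrix.mat (n - 1) (n - 1) (\<lambda>(k, l). F z (if k < j then k else Suc k) (if l < i then l else Suc l))" for z
    by (rule eq_matI) (auto simp: mat_delete_def)
  moreover have "(\<lambda>z. Determinant.det (Matrix.mat (n - 1) (n - 1)
      (\<lambda>(k, l). F z (if k < j then k else Suc k) (if l < i then l else Suc l)))) holomorphic_on S"
    by (rule holomorphic_on_det) (auto intro!: F)
  ultimately show ?thesis
    using ij by (auto simp: adj_mat_def cofactor_def intro!: holomorphic_intros)
qed

lemma ordered_basis_exists: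
  fixes L :: "'a::complex_inner set"
  assumes "fin_dim L"
  shows "ordered_basis L (SOME bs. ordered_basis L bs)"
proof -
  obtain B where B: "finite B" "complex_vector.span B = L"
    using assms by (auto simp: fin_dim_def)
  obtain C where C: "C \<subseteq> B" "complex_vector.independent C" "B \<subseteq> complex_vector.span C"
    using complex_vector.maximal_independent_subset by blast
  have "complex_vector.span C = L"
    using B(2) C(1,3) complex_vector.span_mono complex_vector.span_minimal
      complex_vector.subspace_span by (metis subset_antisym)
  moreover obtain bs where "set bs = C" "distinct bs"
    using finite_distinct_list finite_subset[OF C(1) B(1)] by metis
  ultimately have "ordered_basis L bs" using C(2) by (simp add: ordered_basis_def)
  then show ?thesis by (rule someI)
qed

lemma ordered_basis_expand:
  assumes "ordered_basis L bs" and "v \<in> L"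
  shows "(\<Sum>i<length bs. complex_vector.representation (set bs) v (bs ! i) *\<^sub>C bs ! i) = v"
proof -
  have "(\<Sum>b\<in>set bs. complex_vector.representation (set bs) v b *\<^sub>C b) = v"
    using assms by (intro complex_vector.sum_representation_eq) (auto simp: ordered_basis_def)
  moreover have "bij_betw ((!) bs) {..<length bs} (set bs)"
    using assms by (intro bij_betw_nth) (auto simp: ordered_basis_def)
  ultimately show ?thesis
    by (subst (asm) sum.reindex_bij_betw[symmetric]) auto
qed

lemma operator_on_zero:
  assumes "operator_on D T"
  shows "0 \<in> D" and "T 0 = 0"
proof -
  show "0 \<in> D" using assms by (simp add: operator_on_def complex_vector.subspace_0)
  then have "T (0 *\<^sub>C 0) = 0 *\<^sub>C T 0" using assms unfolding operator_on_def by blast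
  then show "T 0 = 0" by simp
qed

lemma operator_on_sum:
  assumes T: "operator_on L T" and "\<And>i. i \<in> I \<Longrightarrow> f i \<in> L"
  shows "(\<Sum>i\<in>I. c i *\<^sub>C f i) \<in> L \<and> T (\<Sum>i\<in>I. c i *\<^sub>C f i) = (\<Sum>i\<in>I. c i *\<^sub>C T (f i))"
  using assms(2)
proof (induction I rule: infinite_finite_induct)
  case (insert i I)
  have "complex_vector.subspace L" using T by (simp add: operator_on_def)
  then have "c i *\<^sub>C f i \<in> L" "(\<Sum>i\<in>I. c i *\<^sub>C f i) \<in> L"
    using insert by (auto simp: complex_vector.subspace_scale)
  moreover have "T (c i *\<^sub>C f i) = c i *\<^sub>C T (f i)"
    using T insert.prems by (simp add: operator_on_def)
  ultimately show ?case
    using T insert by (auto simp: operator_on_def complex_vector.subspace_add)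
qed (use operator_on_zero[OF T] in auto)

text \<open>
  Cramer's rule exhibits the solution of T x = e as a rational expression in the matrix entries. This
  form makes its holomorphic dependence on a parameter evident.
\<close>

lemma Cramer_solution:
  fixes L :: "'a::complex_inner set"
  assumes bs: "ordered_basis L bs" and T: "operator_on L T" "T ` L \<subseteq> L" and e: "e \<in> L"
  defines "A \<equiv> matrix_wrt bs T"
  defines "a \<equiv> (\<lambda>i. complex_vector.representation (set bs) e (bs ! i))"
  defines "x \<equiv> (\<Sum>j<length bs. (\<Sum>i<length bs. adj_mat A $$ (j, i) * a i / Determinant.det A) *\<^sub>C bs ! j)"
  assumes det: "Determinant.det A \<noteq> 0"
  shows "x \<in> L" and "T x = e"
proof -
  let ?k = "length bs"
  let ?c = "\<lambda>j. \<Sum>i<?k. adj_mat A $$ (j, i) * a i / Determinant.det A"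
  have bL: "bs ! j \<in> L" if "j < ?k" for j
    using bs that complex_vector.span_base nth_mem by (metis ordered_basis_def)
  have A: "A \<in> carrier_mat ?k ?k" by (simp add: A_def matrix_wrt_def)
  have col: "T (bs ! j) = (\<Sum>l<?k. A $$ (l, j) *\<^sub>C bs ! l)" if "j < ?k" for j
  proof -
    have "T (bs ! j) \<in> L" using T(2) bL[OF that] by blast
    from ordered_basis_expand[OF bs this] show ?thesis
      using that by (simp add: A_def matrix_wrt_def)
  qed
  have adj: "(\<Sum>j<?k. A $$ (l, j) * adj_mat A $$ (j, i)) = (if l = i then Determinant.det A else 0)"
    if "l < ?k" "i < ?k" for l i
  proof -
    have "(A * adj_mat A) $$ (l, i) = (\<Sum>j<?k. A $$ (l, j) * adj_mat A $$ (j, i))"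
      using that A adj_mat(1)[OF A] by (simp add: scalar_prod_def atLeast0LessThan)
    moreover have "(A * adj_mat A) $$ (l, i) = (if l = i then Determinant.det A else 0)"
      using that by (simp add: adj_mat(2)[OF A])
    ultimately show ?thesis by simp
  qed
  have xT: "x \<in> L \<and> T x = (\<Sum>j<?k. ?c j *\<^sub>C T (bs ! j))"
    unfolding x_def by (rule operator_on_sum[OF T(1)]) (use bL in auto)
  then show "x \<in> L" by simp
  have Tx: "T x = (\<Sum>j<?k. ?c j *\<^sub>C T (bs ! j))" using xT by simp
  have coef: "(\<Sum>j<?k. ?c j * A $$ (l, j)) = a l" if l: "l < ?k" for l
  proof -
    have "(\<Sum>j<?k. ?c j * A $$ (l, j)) =
        (\<Sum>j<?k. \<Sum>i<?k. A $$ (l, j) * adj_mat A $$ (j, i) * (a i / Determinant.det A))"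
      by (simp add: sum_distrib_right sum_distrib_left mult_ac)
    also have "\<dots> = (\<Sum>i<?k. (\<Sum>j<?k. A $$ (l, j) * adj_mat A $$ (j, i)) * (a i / Determinant.det A))"
      by (subst sum.swap) (simp only: sum_distrib_right)
    also have "\<dots> = (\<Sum>i<?k. if l = i then a i else 0)"
      using l det by (intro sum.cong) (auto simp: adj)
    also have "\<dots> = a l" using l by simp
    finally show ?thesis .
  qed
  have "T x = (\<Sum>j<?k. \<Sum>l<?k. (?c j * A $$ (l, j)) *\<^sub>C bs ! l)"
    unfolding Tx by (intro sum.cong refl) (simp add: col complex_vector.scale_sum_right scaleC_scaleC)
  also have "\<dots> = (\<Sum>l<?k. (\<Sum>j<?k. ?c j * A $$ (l, j)) *\<^sub>C bs ! l)"
    by (subst sum.swap) (simp only: complex_vector.scale_sum_left)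
  also have "\<dots> = (\<Sum>l<?k. a l *\<^sub>C bs ! l)"
    by (intro sum.cong refl) (simp only: coef lessThan_iff)
  also have "\<dots> = e"
    unfolding a_def by (rule ordered_basis_expand[OF bs e])
  finally show "T x = e" .
qed

text \<open>
  An eigenvalue criterion that replaces Rouche's theorem. Suppose that no T z with z in the closed disc
  were singular. Then \<open>X z = (T z)\<^sup>-\<^sup>1 e\<close> is holomorphic there. On the bounding circle T z is close to
  \<open>z\<^sup>2\<close> at e and bounded below, so \<open>z\<^sup>2 X z\<close> is close to e. By the maximum principle
  \<open>z\<^sup>2 \<langle>e, X z\<rangle>\<close> is then close to \<open>\<parallel>e\<parallel>\<^sup>2\<close> also at z = 0, where it vanishes.
\<close>

lemma det_zero_in_disc:
  fixes L :: "'a::complex_inner set" and T :: "complex \<Rightarrow> 'a \<Rightarrow> 'a"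
  assumes bs: "ordered_basis L bs" and T: "\<And>z. operator_on L (T z)" "\<And>z. T z ` L \<subseteq> L"
    and hol: "\<And>i j. i < length bs \<Longrightarrow> j < length bs \<Longrightarrow>
      (\<lambda>z. complex_vector.representation (set bs) (T z (bs ! j)) (bs ! i)) holomorphic_on UNIV"
    and r: "r > 0" and c: "c > 0"
    and low: "\<And>z x. cmod z = r \<Longrightarrow> x \<in> L \<Longrightarrow> c * norm x \<le> norm (T z x)"
    and e: "e \<in> L"
    and near: "\<And>z. cmod z = r \<Longrightarrow> norm (T z e - z\<^sup>2 *\<^sub>C e) \<le> \<kappa>"
    and \<kappa>: "\<kappa> < c * norm e"
  shows "\<exists>z. cmod z \<le> r \<and> Determinant.det (matrix_wrt bs (T z)) = 0"
proof (rule ccontr)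
  assume "\<not> ?thesis"
  then have det: "Determinant.det (matrix_wrt bs (T z)) \<noteq> 0" if "cmod z \<le> r" for z using that by blast
  let ?k = "length bs"
  define a where "a = (\<lambda>i. complex_vector.representation (set bs) e (bs ! i))"
  define X where "X = (\<lambda>z. \<Sum>j<?k. (\<Sum>i<?k. adj_mat (matrix_wrt bs (T z)) $$ (j, i) * a i /
      Determinant.det (matrix_wrt bs (T z))) *\<^sub>C bs ! j)"
  have X: "X z \<in> L" "T z (X z) = e" if "cmod z \<le> r" for z
    unfolding X_def a_def by (rule Cramer_solution[OF bs T e det[OF that]])+
  define h where "h = (\<lambda>z. z\<^sup>2 * cinner e (X z) - cinner e e)"
  have hol_det: "(\<lambda>z. Determinant.det (matrix_wrt bs (T z))) holomorphic_on cball 0 r"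
    unfolding matrix_wrt_def
    by (rule holomorphic_on_det) (rule holomorphic_on_subset[OF hol], auto)
  have hol_adj: "(\<lambda>z. adj_mat (matrix_wrt bs (T z)) $$ (j, i)) holomorphic_on cball 0 r"
    if "j < ?k" "i < ?k" for i j
    unfolding matrix_wrt_def
    by (rule holomorphic_on_adj_mat[OF _ that]) (rule holomorphic_on_subset[OF hol], auto)
  have h: "h holomorphic_on cball 0 r"
    unfolding h_def X_def cinner_sum_right cinner_scaleC_right
    by (intro holomorphic_intros hol_adj hol_det) (auto simp: det)
  have sL: "complex_vector.subspace L" using T(1)[of 0] by (simp add: operator_on_def)
  have bound: "norm (h z) \<le> norm e * (\<kappa> / c)" if z: "cmod z = r" for z
  proof -
    let ?x = "z\<^sup>2 *\<^sub>C X z - e"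
    have xL: "?x \<in> L" using X[of z] z sL e
      by (simp add: complex_vector.subspace_diff complex_vector.subspace_scale)
    have "T z (z\<^sup>2 *\<^sub>C X z) = T z (?x + e)" by simp
    also have "\<dots> = T z ?x + T z e" using T(1)[of z] xL e unfolding operator_on_def by blast
    finally have "T z ?x = T z (z\<^sup>2 *\<^sub>C X z) - T z e" by simp
    also have "\<dots> = z\<^sup>2 *\<^sub>C e - T z e"
      using T(1)[of z] X[of z] z by (simp add: operator_on_def)
    finally have "c * norm ?x \<le> \<kappa>"
      using low[OF z xL] near[OF z] by (simp add: norm_minus_commute)
    then have "norm ?x \<le> \<kappa> / c" using c by (simp add: field_simps)
    moreover have "h z = cinner e ?x"
      by (simp add: h_def cinner_diff_right cinner_scaleC_right)
    ultimately show ?thesis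
      using Cauchy_Schwarz_cinner[of e ?x] mult_left_mono[of "norm ?x" "\<kappa> / c" "norm e"] by simp
  qed
  have "norm (h 0) \<le> norm e * (\<kappa> / c)"
  proof (rule maximum_modulus_frontier[of h "cball 0 r"])
    show "h holomorphic_on interior (cball 0 r)"
      using h by (rule holomorphic_on_subset) (rule interior_subset)
    show "continuous_on (closure (cball 0 r)) h"
      using h by (simp add: holomorphic_on_imp_continuous_on)
    show "norm (h z) \<le> norm e * (\<kappa> / c)" if "z \<in> frontier (cball 0 r)" for z
      using that bound[of z] r by (simp add: dist_norm)
  qed (use r in auto)
  moreover have "norm (h 0) = norm e * norm e"
    by (simp add: h_def norm_cinner power2_eq_square norm_mult)
  moreover have "0 \<le> \<kappa>" using near[of "complex_of_real r"] r by (rule_tac order_trans) auto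
  then have e0: "norm e > 0" using \<kappa> c by (metis le_less_trans zero_less_mult_pos)
  ultimately have "norm e * norm e \<le> norm e * (\<kappa> / c)" by simp
  then have "norm e \<le> \<kappa> / c" using e0 by (rule mult_left_le_imp_le)
  then show False using \<kappa> c by (simp add: field_simps)
qed

lemma representation_quadratic:
  fixes L :: "'a::complex_inner set"
  assumes bs: "ordered_basis L bs"
    and AB: "A ` L \<subseteq> L" "B ` L \<subseteq> L"
    and T: "\<And>x. x \<in> L \<Longrightarrow> T x = z\<^sup>2 *\<^sub>C x - (2 * z) *\<^sub>C A x + B x"
    and ij: "i < length bs" "j < length bs"
  shows "complex_vector.representation (set bs) (T (bs ! j)) (bs ! i) =
    z\<^sup>2 * (if i = j then 1 else 0) - 2 * z * complex_vector.representation (set bs) (A (bs ! j)) (bs ! i)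
      + complex_vector.representation (set bs) (B (bs ! j)) (bs ! i)"
proof -
  have ind: "complex_vector.independent (set bs)" and L: "complex_vector.span (set bs) = L"
    and dis: "distinct bs" using bs by (auto simp: ordered_basis_def)
  have b: "bs ! j \<in> set bs" using ij by simp
  then have bL: "bs ! j \<in> L" using L complex_vector.span_base by blast
  have AL: "A (bs ! j) \<in> L" "B (bs ! j) \<in> L" using AB bL by auto
  have sub: "complex_vector.subspace L" using L complex_vector.subspace_span by metis
  note mem = complex_vector.subspace_scale[OF sub] complex_vector.subspace_diff[OF sub] bL AL
  show ?thesis
    unfolding T[OF bL]
    using ij dis
    by (simp add: complex_vector.representation_add[OF ind] complex_vector.representation_diff[OF ind]
        complex_vector.representation_scale[OF ind] L mem complex_vector.representation_basis[OF ind b]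
        nth_eq_iff_index_eq)
qed

text \<open>
  A monic quadratic matrix polynomial always has an eigenvalue: its determinant behaves like
  \<open>z\<^bsup>2k\<^esup>\<close> at infinity, because the reversed polynomial E has determinant 1 at the origin.
\<close>

lemma quadratic_det_zero:
  fixes a b :: "nat \<Rightarrow> nat \<Rightarrow> complex"
  assumes k: "k > 0"
  shows "\<exists>z. Determinant.det (Matrix.mat k k
    (\<lambda>(i, j). z\<^sup>2 * (if i = j then 1 else 0) - 2 * z * a i j + b i j)) = 0"
proof -
  define F where "F = (\<lambda>z. Determinant.det (Matrix.mat k k
    (\<lambda>(i, j). z\<^sup>2 * (if i = j then 1 else 0) - 2 * z * a i j + b i j)))"
  define E where "E = (\<lambda>w. Determinant.det (Matrix.mat k k
    (\<lambda>(i, j). (if i = j then 1 else 0) - 2 * w * a i j + w\<^sup>2 * b i j)))"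
  have F: "F holomorphic_on UNIV" unfolding F_def
    by (rule holomorphic_on_det) (intro holomorphic_intros)
  have "E holomorphic_on UNIV" unfolding E_def
    by (rule holomorphic_on_det) (intro holomorphic_intros)
  then have "isCont E 0" by (metis holomorphic_on_imp_continuous_on continuous_on_eq_continuous_at open_UNIV UNIV_I)
  moreover have "E 0 = 1"
  proof -
    have "Matrix.mat k k (\<lambda>(i, j). (if i = j then 1 else 0) - 2 * 0 * a i j + 0\<^sup>2 * b i j) = 1\<^sub>m k"
      by (rule eq_matI) auto
    then show ?thesis by (simp add: E_def)
  qed
  ultimately have "\<exists>\<rho>>0. \<forall>w. cmod w < \<rho> \<longrightarrow> cmod (E w - 1) < 1 / 2"
    unfolding continuous_at_eps_delta dist_norm
    by (elim allE[where x = "1 / 2"]) simp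
  then obtain \<rho> where \<rho>: "\<rho> > 0" "\<And>w. cmod w < \<rho> \<Longrightarrow> cmod (E w - 1) < 1 / 2" by blast
  have FE: "F z = (z\<^sup>2) ^ k * E (1 / z)" if "z \<noteq> 0" for z
  proof -
    have "Matrix.mat k k (\<lambda>(i, j). z\<^sup>2 * (if i = j then 1 else 0) - 2 * z * a i j + b i j) =
      z\<^sup>2 \<cdot>\<^sub>m Matrix.mat k k (\<lambda>(i, j). (if i = j then 1 else 0) - 2 * (1 / z) * a i j + (1 / z)\<^sup>2 * b i j)"
      using that by (intro eq_matI) (auto simp: field_simps power2_eq_square)
    then show ?thesis unfolding F_def E_def by (simp add: Determinant.det_smult)
  qed
  have "\<forall>\<^sub>F z in at_infinity. cmod (F z) \<ge> C" for C
    unfolding eventually_at_infinity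
  proof (intro exI allI impI)
    fix z assume z: "1 + 1 / \<rho> + 2 * \<bar>C\<bar> \<le> cmod z"
    moreover have "1 / \<rho> > 0" using \<rho>(1) by simp
    ultimately have z1: "cmod z \<ge> 1" "1 / \<rho> < cmod z" "2 * C \<le> cmod z" by linarith+
    have z0: "z \<noteq> 0" using z1(1) by auto
    have "cmod (1 / z) < \<rho>" using z1(2) \<rho>(1) z0 by (simp add: norm_divide field_simps)
    from \<rho>(2)[OF this] have "cmod (E (1 / z)) \<ge> 1 / 2"
      using norm_triangle_ineq2[of 1 "1 - E (1 / z)"] by (simp add: norm_minus_commute)
    moreover have "cmod z \<le> cmod z ^ (2 * k)"
      using power_increasing[of 1 "2 * k" "cmod z"] k z1(1) by simp
    ultimately have "cmod z * (1 / 2) \<le> cmod z ^ (2 * k) * cmod (E (1 / z))"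
      by (intro mult_mono) auto
    also have "\<dots> = cmod (F z)" using FE[OF z0] by (simp add: norm_mult norm_power power_mult)
    finally show "C \<le> cmod (F z)" using z1(3) by simp
  qed
  then obtain z where "F z = 0" using Liouville_weak_inverse[OF F] by blast
  then show ?thesis unfolding F_def by blast
qed

section \<open>The quadratic polynomial near an isolated eigenvalue at 0\<close>

lemma quad_poly_operator_on_range:
  fixes M :: "'a::complex_inner \<Rightarrow> 'a"
  assumes M: "operator_on D M" and P: "orth_projection P" and sub: "range P \<subseteq> dom_square D M"
  shows "operator_on (range P) (quad_poly M P z)"
proof -
  interpret P: Vector_Spaces.linear scaleC scaleC P
    using P by (simp add: orth_projection_def)
  have sR: "complex_vector.subspace (range P)"
    using P.subspace_image[OF complex_vector.subspace_UNIV] .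
  have add: "\<And>x y. x \<in> D \<Longrightarrow> y \<in> D \<Longrightarrow> M (x + y) = M x + M y"
    and scale: "\<And>a x. x \<in> D \<Longrightarrow> M (a *\<^sub>C x) = a *\<^sub>C M x"
    using M by (auto simp: operator_on_def)
  have D: "x \<in> D" "M x \<in> D" if "x \<in> range P" for x using sub that by (auto simp: dom_square_def)
  note expand = quad_poly_expand[OF M P sub]
  have "quad_poly M P z (x + y) = quad_poly M P z x + quad_poly M P z y"
    if "x \<in> range P" "y \<in> range P" for x y
    unfolding expand[OF that(1)] expand[OF that(2)] expand[OF complex_vector.subspace_add[OF sR that]]
    by (simp add: add D that P.add scaleC_add_right)
  moreover have "quad_poly M P z (a *\<^sub>C x) = a *\<^sub>C quad_poly M P z x" if "x \<in> range P" for a x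
    unfolding expand[OF that] expand[OF complex_vector.subspace_scale[OF sR that]]
    by (simp add: scale D that P.scale scaleC_add_right complex_vector.scale_right_diff_distrib
        scaleC_scaleC mult.commute)
  ultimately show ?thesis using sR unfolding operator_on_def by blast
qed

lemma quad_poly_entries:
  fixes M :: "'a::complex_inner \<Rightarrow> 'a"
  assumes M: "operator_on D M" and P: "orth_projection P" and sub: "range P \<subseteq> dom_square D M"
    and bs: "ordered_basis (range P) bs" and ij: "i < length bs" "j < length bs"
  shows "complex_vector.representation (set bs) (quad_poly M P z (bs ! j)) (bs ! i) =
    z\<^sup>2 * (if i = j then 1 else 0)
      - 2 * z * complex_vector.representation (set bs) (P (M (bs ! j))) (bs ! i)
      + complex_vector.representation (set bs) (P (M (M (bs ! j)))) (bs ! i)"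
  by (rule representation_quadratic[OF bs _ _ quad_poly_expand[OF M P sub] ij]) auto

lemma quad_spectrum_nonempty:
  fixes M :: "'a::complex_inner \<Rightarrow> 'a"
  assumes M: "operator_on D M" and P: "orth_projection P" and sub: "range P \<subseteq> dom_square D M"
    and fin: "fin_dim (range P)" and nz: "range P \<noteq> {0}"
  shows "\<exists>z. z \<in> quad_spectrum M P"
proof -
  define bs where "bs = (SOME bs. ordered_basis (range P) bs)"
  have bs: "ordered_basis (range P) bs" unfolding bs_def by (rule ordered_basis_exists[OF fin])
  have "bs \<noteq> []" using bs nz by (auto simp: ordered_basis_def complex_vector.span_empty)
  then have k: "length bs > 0" by simp
  have mat: "matrix_wrt bs (quad_poly M P z) = Matrix.mat (length bs) (length bs) (\<lambda>(i, j).
      z\<^sup>2 * (if i = j then 1 else 0)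
      - 2 * z * complex_vector.representation (set bs) (P (M (bs ! j))) (bs ! i)
      + complex_vector.representation (set bs) (P (M (M (bs ! j)))) (bs ! i))" for z
    unfolding matrix_wrt_def using quad_poly_entries[OF M P sub bs] by (intro eq_matI) auto
  show ?thesis
    unfolding quad_spectrum_def op_det_def bs_def[symmetric] mem_Collect_eq mat
    by (rule quadratic_det_zero[OF k])
qed

text \<open>
  The quantitative core: on a circle around 0 of small radius r, large compared with the square root
  of the defect d, the quadratic polynomial is bounded below by \<open>r\<^sup>2 / 4\<close>. Let x be a unit vector at which
  it is smaller. Pairing with x itself, the quadratic form is \<open>z\<^sup>2 - 2 z \<langle>x, N x\<rangle> + \<parallel>N x\<parallel>\<^sup>2\<close>; it can only be
  small if \<open>\<parallel>N x\<parallel>\<close> is of order r, so by the spectral gap x is close to a vector q in the kernel. Pairing with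
  q, the terms containing N are of the order of d, and \<open>z\<^sup>2 \<langle>q, x\<rangle>\<close>, of modulus nearly \<open>r\<^sup>2\<close>, remains:
  a contradiction.
\<close>

lemma quad_poly_lower_bound:
  fixes N :: "'a::complex_inner \<Rightarrow> 'a"
  assumes sa: "self_adjoint D N" and P: "orth_projection P" and sub: "range P \<subseteq> dom_square D N"
    and \<beta>: "\<beta> > 0"
    and gap: "\<And>u. u \<in> D \<Longrightarrow> \<exists>q\<in>D. N q = 0 \<and> norm q \<le> norm u \<and> \<beta> * norm (u - q) \<le> norm (N u)"
    and near1: "\<And>\<psi>. \<psi> \<in> D \<Longrightarrow> N \<psi> = 0 \<Longrightarrow> norm (P (N (P \<psi>))) \<le> d * norm \<psi>"
    and near2: "\<And>\<psi>. \<psi> \<in> D \<Longrightarrow> N \<psi> = 0 \<Longrightarrow> norm (P (N (N (P \<psi>)))) \<le> d * norm \<psi>"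
    and d: "d \<ge> 0"
    and r: "r > 0" "r \<le> 1" "15 * r \<le> \<beta>" "48 * d \<le> r\<^sup>2"
    and z: "cmod z = r" and x: "x \<in> range P"
  shows "r\<^sup>2 / 4 * norm x \<le> norm (quad_poly N P z x)"
proof -
  have N: "operator_on D N" using sa by (simp add: self_adjoint_def)
  note sym = self_adjoint_symmetric[OF sa]
  interpret P: Vector_Spaces.linear scaleC scaleC P
    using P by (simp add: orth_projection_def)
  have PP: "P (P u) = P u" and Psym: "cinner (P u) v = cinner u (P v)" for u v
    using P by (auto simp: orth_projection_def)
  have DP: "u \<in> D" "N u \<in> D" "P u = u" if "u \<in> range P" for u
    using sub that PP by (auto simp: dom_square_def)
  note expand = quad_poly_expand[OF N P sub]
  have T: "operator_on (range P) (quad_poly N P z)"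
    by (rule quad_poly_operator_on_range[OF N P sub])
  have unit: "r\<^sup>2 / 4 \<le> norm (quad_poly N P z x)" if x: "x \<in> range P" and x1: "norm x = 1" for x
  proof (rule ccontr)
    define y where "y = quad_poly N P z x"
    assume "\<not> ?thesis"
    then have y: "norm y < r\<^sup>2 / 4" by (simp add: y_def)
    have yeq: "y = z\<^sup>2 *\<^sub>C x - (2 * z) *\<^sub>C P (N x) + P (N (N x))"
      unfolding y_def by (rule expand[OF x])
    have "cinner x (P (N x)) = cinner x (N x)" "cinner x (P (N (N x))) = cinner (N x) (N x)"
      using DP[OF x] by (simp_all add: Psym[symmetric] sym)
    then have "complex_of_real ((norm (N x))\<^sup>2) = cinner x y - z\<^sup>2 + 2 * z * cinner x (N x)"
      by (simp add: yeq cinner_add_right cinner_diff_right cinner_scaleC_right norm_cinner x1)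
    then have "(norm (N x))\<^sup>2 = cmod (cinner x y - z\<^sup>2 + 2 * z * cinner x (N x))"
      by (metis abs_of_nonneg norm_of_real zero_le_power2)
    also have "\<dots> \<le> cmod (cinner x y) + r\<^sup>2 + 2 * r * cmod (cinner x (N x))"
      using norm_triangle_ineq[of "cinner x y - z\<^sup>2" "2 * z * cinner x (N x)"]
        norm_triangle_ineq4[of "cinner x y" "z\<^sup>2"] z by (simp add: norm_mult norm_power)
    also have "cmod (cinner x y) \<le> norm y" using Cauchy_Schwarz_cinner[of x y] x1 by simp
    also have "2 * r * cmod (cinner x (N x)) \<le> 2 * r * norm (N x)"
      using Cauchy_Schwarz_cinner[of x "N x"] x1 r(1) by simp
    finally have quad: "(norm (N x))\<^sup>2 \<le> norm y + r\<^sup>2 + 2 * r * norm (N x)" by simp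
    \<comment> \<open>At t = 5 r / 2 the left side of \<open>t (t - 2 r) \<le> r\<^sup>2 + r\<^sup>2 / 4\<close> reaches the right side.\<close>
    have "norm (N x) \<le> 5 / 2 * r"
    proof (rule ccontr)
      assume "\<not> ?thesis"
      then have "(5 / 2 * r) * (r / 2) \<le> norm (N x) * (norm (N x) - 2 * r)"
        using r(1) by (intro mult_mono) auto
      then have "5 / 4 * r\<^sup>2 \<le> (norm (N x))\<^sup>2 - 2 * r * norm (N x)"
        by (simp add: algebra_simps power2_eq_square)
      then show False using quad y by linarith
    qed
    moreover obtain q where q: "q \<in> D" "N q = 0" "norm q \<le> 1" "\<beta> * norm (x - q) \<le> norm (N x)"
      using gap[OF DP(1)[OF x]] x1 by auto
    ultimately have "\<beta> * norm (x - q) \<le> \<beta> * (1 / 6)" using r(3) by linarith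
    then have xq: "norm (x - q) \<le> 1 / 6" using \<beta> by simp
    have "cinner q x = 1 - cinner (x - q) x"
      by (simp add: cinner_diff_left norm_cinner x1)
    moreover have "cmod (cinner (x - q) x) \<le> 1 / 6"
      using Cauchy_Schwarz_cinner[of "x - q" x] x1 xq by simp
    ultimately have qx: "5 / 6 \<le> cmod (cinner q x)"
      using norm_triangle_ineq2[of 1 "cinner (x - q) x"] by simp
    have Pq: "P q \<in> range P" by simp
    have "cinner q (P (N x)) = cinner (P (N (P q))) x"
      using Psym[of q "N x"] Psym[of "N (P q)" x] sym[of x "P q"] DP[OF x] DP[OF Pq] by simp
    moreover have "cinner q (P (N (N x))) = cinner (P (N (N (P q)))) x"
      using Psym[of q "N (N x)"] Psym[of "N (N (P q))" x] sym[of x "N (P q)"] sym[of "N x" "P q"]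
        DP[OF x] DP[OF Pq] by simp
    ultimately have "z\<^sup>2 * cinner q x =
        cinner q y + 2 * z * cinner (P (N (P q))) x - cinner (P (N (N (P q)))) x"
      by (simp add: yeq cinner_add_right cinner_diff_right cinner_scaleC_right)
    then have "r\<^sup>2 * cmod (cinner q x) =
        cmod (cinner q y + 2 * z * cinner (P (N (P q))) x - cinner (P (N (N (P q)))) x)"
      using z by (metis norm_mult norm_power)
    also have "\<dots> \<le> cmod (cinner q y) + 2 * r * cmod (cinner (P (N (P q))) x)
        + cmod (cinner (P (N (N (P q)))) x)"
      using norm_triangle_ineq4[of "cinner q y + 2 * z * cinner (P (N (P q))) x" "cinner (P (N (N (P q)))) x"]
        norm_triangle_ineq[of "cinner q y" "2 * z * cinner (P (N (P q))) x"] z by (simp add: norm_mult)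
    also have "cmod (cinner q y) \<le> norm y"
      using Cauchy_Schwarz_cinner[of q y] mult_right_mono[OF q(3), of "norm y"] by simp
    also have "cmod (cinner (P (N (N (P q)))) x) \<le> d"
      using Cauchy_Schwarz_cinner[of "P (N (N (P q)))" x] near2[OF q(1,2)]
        mult_left_mono[OF q(3) d] x1 by simp
    also have "2 * r * cmod (cinner (P (N (P q))) x) \<le> 2 * 1 * d"
    proof (intro mult_mono)
      show "cmod (cinner (P (N (P q))) x) \<le> d"
        using Cauchy_Schwarz_cinner[of "P (N (P q))" x] near1[OF q(1,2)]
          mult_left_mono[OF q(3) d] x1 by simp
    qed (use r in auto)
    \<comment> \<open>The right side is less than \<open>r\<^sup>2 / 4 + r\<^sup>2 / 16\<close>, the left side at least \<open>5 r\<^sup>2 / 6\<close>.\<close>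
    finally have "r\<^sup>2 * cmod (cinner q x) \<le> norm y + 3 * d" by simp
    moreover have "r\<^sup>2 * (5 / 6) \<le> r\<^sup>2 * cmod (cinner q x)" using qx by (intro mult_left_mono) auto
    moreover have "r\<^sup>2 > 0" using r(1) by simp
    ultimately show False using y r(4) by linarith
  qed
  show ?thesis
  proof (cases "x = 0")
    case False
    define c where "c = complex_of_real (1 / norm x)"
    have sR: "complex_vector.subspace (range P)" using T by (simp add: operator_on_def)
    have "c *\<^sub>C x \<in> range P" by (rule complex_vector.subspace_scale[OF sR x])
    moreover have "norm (c *\<^sub>C x) = 1" using False by (simp add: norm_scaleC c_def norm_divide)
    ultimately have "r\<^sup>2 / 4 \<le> norm (quad_poly N P z (c *\<^sub>C x))" by (rule unit)
    also have "quad_poly N P z (c *\<^sub>C x) = c *\<^sub>C quad_poly N P z x"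
      using T x unfolding operator_on_def by blast
    finally show ?thesis using False by (simp add: norm_scaleC c_def norm_divide field_simps)
  qed simp
qed

text \<open>
  The criterion \<open>det_zero_in_disc\<close> applies with e the projection of a unit vector in the kernel: its
  norm is close to 1, and for T the quadratic polynomial the norm of \<open>T z e - z\<^sup>2 e\<close> is at most 3 d, hence
  small against the lower bound \<open>r\<^sup>2 / 4\<close>.
\<close>

lemma quad_spectrum_near_zero:
  fixes N :: "'a::complex_inner \<Rightarrow> 'a"
  assumes sa: "self_adjoint D N" and P: "orth_projection P" and sub: "range P \<subseteq> dom_square D N"
    and fin: "fin_dim (range P)"
    and \<beta>: "\<beta> > 0"
    and gap: "\<And>u. u \<in> D \<Longrightarrow> \<exists>q\<in>D. N q = 0 \<and> norm q \<le> norm u \<and> \<beta> * norm (u - q) \<le> norm (N u)"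
    and near0: "\<And>\<psi>. \<psi> \<in> D \<Longrightarrow> N \<psi> = 0 \<Longrightarrow> norm (P \<psi> - \<psi>) \<le> d * norm \<psi>"
    and near1: "\<And>\<psi>. \<psi> \<in> D \<Longrightarrow> N \<psi> = 0 \<Longrightarrow> norm (P (N (P \<psi>))) \<le> d * norm \<psi>"
    and near2: "\<And>\<psi>. \<psi> \<in> D \<Longrightarrow> N \<psi> = 0 \<Longrightarrow> norm (P (N (N (P \<psi>)))) \<le> d * norm \<psi>"
    and \<psi>: "\<psi> \<in> D" "N \<psi> = 0" "norm \<psi> = 1"
    and r: "r > 0" "r \<le> 1" "15 * r \<le> \<beta>" "48 * d \<le> r\<^sup>2"
  shows "\<exists>z. cmod z \<le> r \<and> z \<in> quad_spectrum N P"
proof -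
  have N: "operator_on D N" using sa by (simp add: self_adjoint_def)
  have d: "d \<ge> 0" using near0[OF \<psi>(1,2)] \<psi>(3) by (rule_tac order_trans) auto
  define bs where "bs = (SOME bs. ordered_basis (range P) bs)"
  have bs: "ordered_basis (range P) bs" unfolding bs_def by (rule ordered_basis_exists[OF fin])
  define e where "e = P \<psi>"
  have e: "e \<in> range P" by (simp add: e_def)
  have r1: "r\<^sup>2 \<le> 1" using r(1,2) by (simp add: power_le_one)
  have e1: "47 / 48 \<le> norm e"
    using near0[OF \<psi>(1,2)] \<psi>(3) r(4) r1 norm_triangle_ineq2[of \<psi> "\<psi> - P \<psi>"]
    by (simp add: e_def norm_minus_commute)
  have "\<exists>z. cmod z \<le> r \<and> Determinant.det (matrix_wrt bs (quad_poly N P z)) = 0"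
  proof (rule det_zero_in_disc[OF bs, where c = "r\<^sup>2 / 4" and e = e and \<kappa> = "3 * d"])
    show "operator_on (range P) (quad_poly N P z)" for z
      by (rule quad_poly_operator_on_range[OF N P sub])
    show "quad_poly N P z ` range P \<subseteq> range P" for z
      by (auto simp: quad_poly_def)
    show "(\<lambda>z. complex_vector.representation (set bs) (quad_poly N P z (bs ! j)) (bs ! i)) holomorphic_on UNIV"
      if "i < length bs" "j < length bs" for i j
      unfolding quad_poly_entries[OF N P sub bs that] by (intro holomorphic_intros)
    show "r\<^sup>2 / 4 * norm x \<le> norm (quad_poly N P z x)" if "cmod z = r" "x \<in> range P" for z x
      by (rule quad_poly_lower_bound[OF sa P sub \<beta> gap near1 near2 d r that])
    show "norm (quad_poly N P z e - z\<^sup>2 *\<^sub>C e) \<le> 3 * d" if z: "cmod z = r" for z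
    proof -
      have "quad_poly N P z e - z\<^sup>2 *\<^sub>C e = P (N (N e)) - (2 * z) *\<^sub>C P (N e)"
        unfolding quad_poly_expand[OF N P sub e] by simp
      then have "norm (quad_poly N P z e - z\<^sup>2 *\<^sub>C e) \<le> norm (P (N (N e))) + 2 * r * norm (P (N e))"
        using norm_triangle_ineq4[of "P (N (N e))" "(2 * z) *\<^sub>C P (N e)"] z
        by (simp add: norm_scaleC norm_mult)
      moreover have "norm (P (N (N e))) \<le> d" "norm (P (N e)) \<le> d"
        using near1[OF \<psi>(1,2)] near2[OF \<psi>(1,2)] \<psi>(3) by (simp_all add: e_def)
      moreover have "2 * r * norm (P (N e)) \<le> 2 * 1 * d"
        using r(1,2) calculation(3) d by (intro mult_mono) auto
      ultimately show ?thesis by linarith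
    qed
    have "r\<^sup>2 / 4 * (47 / 48) \<le> r\<^sup>2 / 4 * norm e" using e1 by (intro mult_left_mono) auto
    moreover have "r\<^sup>2 > 0" using r(1) by simp
    ultimately show "3 * d < r\<^sup>2 / 4 * norm e" using r(4) by linarith
  qed (use r e in auto)
  then show ?thesis by (simp add: quad_spectrum_def op_det_def bs_def)
qed

section \<open>Reduction to the eigenvalue 0\<close>

lemma shifted_translate: "shifted M (c + z) = shifted (\<lambda>x. M x - c *\<^sub>C x) z"
  by (rule ext) (simp add: shifted_def scaleC_add_left)

lemma quad_poly_translate: "quad_poly M P (c + z) = quad_poly (\<lambda>x. M x - c *\<^sub>C x) P z"
  by (rule ext) (simp add: quad_poly_def shifted_translate)

lemma quad_spectrum_translate:
  "c + z \<in> quad_spectrum M P \<longleftrightarrow> z \<in> quad_spectrum (\<lambda>x. M x - c *\<^sub>C x) P"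
  by (simp add: quad_spectrum_def quad_poly_translate)

lemma resolvent_set_translate:
  "c + z \<in> resolvent_set D M \<longleftrightarrow> z \<in> resolvent_set D (\<lambda>x. M x - c *\<^sub>C x)"
  by (simp add: resolvent_set_def shifted_translate)

text \<open>
  The approximation hypotheses for the powers of M become statements about N = M - c: expanding the powers
  of M - c costs the binomial factor \<open>(1 + \<bar>c\<bar>)\<^sup>2\<close>.
\<close>

lemma approximate_eigenspace_shift:
  fixes M :: "'a::complex_inner \<Rightarrow> 'a"
  assumes M: "operator_on D M" and N_def: "N = (\<lambda>x. M x - c *\<^sub>C x)" and N: "operator_on D N"
    and P: "orth_projection P" and sub: "range P \<subseteq> dom_square D M" and subN: "range P \<subseteq> dom_square D N"
    and approx: "\<And>\<psi> k. \<psi> \<in> D \<Longrightarrow> M \<psi> = c *\<^sub>C \<psi> \<Longrightarrow> norm \<psi> = 1 \<Longrightarrow> k \<in> {0, 1, 2} \<Longrightarrow>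
           norm (P ((M ^^ k) (P \<psi>)) - c ^ k *\<^sub>C \<psi>) \<le> \<delta>"
    and \<delta>: "\<delta> \<ge> 0"
    and \<psi>: "\<psi> \<in> D" "N \<psi> = 0"
  defines "d \<equiv> (1 + cmod c)\<^sup>2 * \<delta>"
  shows "norm (P \<psi> - \<psi>) \<le> d * norm \<psi>"
    and "norm (P (N (P \<psi>))) \<le> d * norm \<psi>"
    and "norm (P (N (N (P \<psi>)))) \<le> d * norm \<psi>"
proof -
  interpret P: Vector_Spaces.linear scaleC scaleC P
    using P by (simp add: orth_projection_def)
  have PP: "P (P u) = P u" for u using P by (auto simp: orth_projection_def)
  have dexp: "d = \<delta> + 2 * cmod c * \<delta> + (cmod c)\<^sup>2 * \<delta>"
    by (simp add: d_def power2_eq_square algebra_simps)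
  have nn: "0 \<le> cmod c * \<delta>" "0 \<le> (cmod c)\<^sup>2 * \<delta>" using \<delta> by auto
  have unit: "norm (P u - u) \<le> d \<and> norm (P (N (P u))) \<le> d \<and> norm (P (N (N (P u)))) \<le> d"
    if u: "u \<in> D" "N u = 0" "norm u = 1" for u
  proof (intro conjI)
    have Mu: "M u = c *\<^sub>C u" using u(2) by (simp add: N_def)
    \<comment> \<open>The three defects, each of norm at most \<open>\<delta>\<close>, of which the vectors to be estimated are combinations.\<close>
    define a0 where "a0 = P u - u"
    define a1 where "a1 = P (M (P u)) - c *\<^sub>C u"
    define a2 where "a2 = P (M (M (P u))) - c\<^sup>2 *\<^sub>C u"
    have a0: "norm a0 \<le> \<delta>"
      using approx[OF u(1) Mu u(3), of 0] by (simp add: a0_def PP scaleC_one)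
    have a1: "norm a1 \<le> \<delta>"
      using approx[OF u(1) Mu u(3), of 1] by (simp add: a1_def)
    have a2: "norm a2 \<le> \<delta>"
      using approx[OF u(1) Mu u(3), of 2] by (simp add: a2_def numeral_2_eq_2)
    show "norm (P u - u) \<le> d" using a0 nn unfolding a0_def[symmetric] dexp by linarith
    have "P (N (P u)) = a1 - c *\<^sub>C a0"
      by (simp add: N_def a1_def a0_def P.diff P.scale PP complex_vector.scale_right_diff_distrib)
    then have "norm (P (N (P u))) \<le> norm a1 + cmod c * norm a0"
      using norm_triangle_ineq4[of a1 "c *\<^sub>C a0"] by (simp add: norm_scaleC)
    moreover have "cmod c * norm a0 \<le> cmod c * \<delta>" using a0 by (intro mult_left_mono) auto
    ultimately show "norm (P (N (P u))) \<le> d" using a1 nn unfolding dexp by linarith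
    have Pu: "P u \<in> range P" by simp
    have "P (N (N (P u))) = quad_poly N P 0 (P u)"
      unfolding quad_poly_expand[OF N P subN Pu] by simp
    also have "\<dots> = quad_poly M P c (P u)"
      unfolding N_def quad_poly_translate[symmetric] by simp
    also have "\<dots> = c\<^sup>2 *\<^sub>C P u - (2 * c) *\<^sub>C P (M (P u)) + P (M (M (P u)))"
      by (rule quad_poly_expand[OF M P sub Pu])
    also have "\<dots> = c\<^sup>2 *\<^sub>C a0 - (2 * c) *\<^sub>C a1 + a2"
    proof -
      have "(2 * c) *\<^sub>C (c *\<^sub>C u) = c\<^sup>2 *\<^sub>C u + c\<^sup>2 *\<^sub>C u"
        by (simp add: scaleC_scaleC power2_eq_square flip: scaleC_add_left)
      then show ?thesis
        by (simp add: a0_def a1_def a2_def complex_vector.scale_right_diff_distrib)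
    qed
    finally have "norm (P (N (N (P u)))) \<le> (cmod c)\<^sup>2 * norm a0 + 2 * cmod c * norm a1 + norm a2"
      using norm_triangle_ineq[of "c\<^sup>2 *\<^sub>C a0 - (2 * c) *\<^sub>C a1" a2]
        norm_triangle_ineq4[of "c\<^sup>2 *\<^sub>C a0" "(2 * c) *\<^sub>C a1"]
      by (simp add: norm_scaleC norm_power norm_mult)
    moreover have "(cmod c)\<^sup>2 * norm a0 \<le> (cmod c)\<^sup>2 * \<delta>" "2 * cmod c * norm a1 \<le> 2 * cmod c * \<delta>"
      using a0 a1 by (intro mult_left_mono, auto)+
    ultimately show "norm (P (N (N (P u)))) \<le> d" using a2 unfolding dexp by linarith
  qed
  have scale: "\<And>a x. x \<in> D \<Longrightarrow> N (a *\<^sub>C x) = a *\<^sub>C N x" and sD: "complex_vector.subspace D"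
    using N by (auto simp: operator_on_def)
  have Pd: "P x \<in> D" "N (P x) \<in> D" for x using subN by (auto simp: dom_square_def)
  have "norm (P \<psi> - \<psi>) \<le> d * norm \<psi> \<and> norm (P (N (P \<psi>))) \<le> d * norm \<psi> \<and>
    norm (P (N (N (P \<psi>)))) \<le> d * norm \<psi>"
  proof (cases "\<psi> = 0")
    case True
    then show ?thesis using \<psi>(2) by (simp add: P.zero)
  next
    case False
    define t where "t = complex_of_real (1 / norm \<psi>)"
    have t: "cmod t = 1 / norm \<psi>" by (simp add: t_def norm_divide)
    have "t *\<^sub>C \<psi> \<in> D" "N (t *\<^sub>C \<psi>) = 0" "norm (t *\<^sub>C \<psi>) = 1"
      using \<psi> sD False by (auto simp: complex_vector.subspace_scale scale norm_scaleC t)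
    note u = unit[OF this]
    have "P (t *\<^sub>C \<psi>) - t *\<^sub>C \<psi> = t *\<^sub>C (P \<psi> - \<psi>)"
      "P (N (P (t *\<^sub>C \<psi>))) = t *\<^sub>C P (N (P \<psi>))"
      "P (N (N (P (t *\<^sub>C \<psi>)))) = t *\<^sub>C P (N (N (P \<psi>)))"
      by (simp_all only: P.scale scale Pd complex_vector.scale_right_diff_distrib)
    with u have "norm (P \<psi> - \<psi>) / norm \<psi> \<le> d" "norm (P (N (P \<psi>))) / norm \<psi> \<le> d"
      "norm (P (N (N (P \<psi>)))) / norm \<psi> \<le> d"
      by (simp_all only: norm_scaleC t) simp_all
    then show ?thesis using False by (simp add: pos_divide_le_eq)
  qed
  then show "norm (P \<psi> - \<psi>) \<le> d * norm \<psi>" "norm (P (N (P \<psi>))) \<le> d * norm \<psi>"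
    "norm (P (N (N (P \<psi>)))) \<le> d * norm \<psi>" by auto
qed

theorem theorem1:
  fixes D :: "'a::chilbert_space set" and M :: "'a \<Rightarrow> 'a"
    and P :: "nat \<Rightarrow> 'a \<Rightarrow> 'a" and lam :: complex and \<delta> :: "nat \<Rightarrow> real"
  assumes "separable_space (euclidean :: 'a topology)"
    and "self_adjoint D M"
    and "\<And>n. orth_projection (P n)"
    and "\<And>n. range (P n) \<noteq> {0}"
    and "\<And>n. fin_dim (range (P n))"
    and "\<And>n. range (P n) \<subseteq> dom_square D M"
    and "lam \<in> disc_spectrum D M"
    and "\<And>n. \<delta> n > 0"
    and "\<delta> \<longlonglongrightarrow> 0"
    and "\<And>\<psi> n k. \<psi> \<in> D \<Longrightarrow> M \<psi> = lam *\<^sub>C \<psi> \<Longrightarrow> norm \<psi> = 1 \<Longrightarrow> k \<in> {0, 1, 2} \<Longrightarrow>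
           norm (P n ((M ^^ k) (P n \<psi>)) - lam ^ k *\<^sub>C \<psi>) \<le> \<delta> n"
  shows "\<exists>b>0. \<exists>z :: nat \<Rightarrow> complex. \<forall>n.
           z n \<in> quad_spectrum M (P n) \<and> cmod (z n - lam) < b * sqrt (\<delta> n)"
proof -
  note sa = assms(2) and P = assms(3) and nz = assms(4) and fin = assms(5) and sub = assms(6)
    and \<delta> = assms(8) and lim = assms(9) and approx = assms(10)
  have M: "operator_on D M" and sD: "complex_vector.subspace D"
    using sa by (auto simp: self_adjoint_def operator_on_def)
  have iso: "lam isolated_in spectrum D M" and "eigenspace D M lam \<noteq> {0}"
    using assms(7) by (auto simp: disc_spectrum_def)
  moreover have "0 \<in> eigenspace D M lam"
    using operator_on_zero[OF M] by (simp add: eigenspace_def)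
  ultimately obtain \<psi>0 where \<psi>0: "\<psi>0 \<in> eigenspace D M lam" "\<psi>0 \<noteq> 0" by blast
  define N where "N = (\<lambda>x. M x - lam *\<^sub>C x)"
  have saN: "self_adjoint D N"
    unfolding N_def by (rule self_adjoint_shift[OF sa self_adjoint_eigenvalue_real[OF sa \<psi>0]])
  have N: "operator_on D N" using saN by (simp add: self_adjoint_def)
  define \<psi> where "\<psi> = complex_of_real (1 / norm \<psi>0) *\<^sub>C \<psi>0"
  have \<psi>: "\<psi> \<in> D" "N \<psi> = 0" "norm \<psi> = 1"
  proof -
    have \<psi>0D: "\<psi>0 \<in> D" "N \<psi>0 = 0" using \<psi>0 by (auto simp: eigenspace_def N_def)
    then show "\<psi> \<in> D" using sD by (simp only: \<psi>_def complex_vector.subspace_scale)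
    have "N \<psi> = complex_of_real (1 / norm \<psi>0) *\<^sub>C N \<psi>0"
      using N \<psi>0D(1) unfolding \<psi>_def operator_on_def by blast
    then show "N \<psi> = 0" by (simp add: \<psi>0D)
    show "norm \<psi> = 1" using \<psi>0(2) by (simp add: \<psi>_def norm_scaleC norm_divide)
  qed
  have subN: "range (P n) \<subseteq> dom_square D N" for n
    using sub[of n] sD by (auto simp: dom_square_def N_def complex_vector.subspace_diff
        complex_vector.subspace_scale subset_iff)
  obtain \<epsilon> where \<epsilon>: "\<epsilon> > 0" "\<And>w. w \<in> spectrum D M \<Longrightarrow> dist lam w < \<epsilon> \<Longrightarrow> w = lam"
    using iso unfolding isolated_in_dist_Ex_iff by blast
  have "\<zeta> \<in> resolvent_set D N" if "\<zeta> \<noteq> 0" "cmod \<zeta> < \<epsilon>" for \<zeta>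
    using \<epsilon>(2)[of "lam + \<zeta>"] that
    by (auto simp: N_def spectrum_def dist_norm simp flip: resolvent_set_translate)
  then obtain \<beta> where \<beta>: "\<beta> > 0"
    and gap: "\<And>u. u \<in> D \<Longrightarrow> \<exists>q\<in>D. N q = 0 \<and> norm q \<le> norm u \<and> \<beta> * norm (u - q) \<le> norm (N u)"
    using isolated_spectral_gap[OF saN \<epsilon>(1)] by metis
  \<comment> \<open>The radius \<open>C * sqrt (\<delta> n)\<close> satisfies \<open>48 * d = r\<^sup>2\<close> for the defect d of the shifted operator.\<close>
  define C where "C = sqrt 48 * (1 + cmod lam)"
  have C: "C > 0" by (simp add: C_def add_pos_nonneg)
  have "(\<lambda>n. C * sqrt (\<delta> n)) \<longlonglongrightarrow> C * sqrt 0"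
    by (intro tendsto_intros lim)
  then have "\<forall>\<^sub>F n in sequentially. C * sqrt (\<delta> n) < min 1 (\<beta> / 15)"
    using \<beta> by (intro order_tendstoD(2)) auto
  then obtain n0 where n0: "\<And>n. n \<ge> n0 \<Longrightarrow> C * sqrt (\<delta> n) < min 1 (\<beta> / 15)"
    by (auto simp: eventually_sequentially)
  have "\<exists>z. z \<in> quad_spectrum M (P n) \<and> (n \<ge> n0 \<longrightarrow> cmod (z - lam) \<le> C * sqrt (\<delta> n))" for n
  proof (cases "n \<ge> n0")
    case True
    define d where "d = (1 + cmod lam)\<^sup>2 * \<delta> n"
    have near: "norm (P n \<phi> - \<phi>) \<le> d * norm \<phi>" "norm (P n (N (P n \<phi>))) \<le> d * norm \<phi>"
      "norm (P n (N (N (P n \<phi>)))) \<le> d * norm \<phi>" if \<phi>: "\<phi> \<in> D" "N \<phi> = 0" for \<phi>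
      unfolding d_def
      by (rule approximate_eigenspace_shift[OF M N_def N P sub subN approx less_imp_le[OF \<delta>] \<phi>];
          assumption)+
    have "\<exists>z. cmod z \<le> C * sqrt (\<delta> n) \<and> z \<in> quad_spectrum N (P n)"
    proof (rule quad_spectrum_near_zero[OF saN P subN fin \<beta> gap near(1) near(2) near(3) \<psi>])
      show "48 * d \<le> (C * sqrt (\<delta> n))\<^sup>2"
        using \<delta>[of n] by (simp add: d_def C_def power_mult_distrib)
    qed (use n0[OF True] C \<delta>[of n] in auto)
    then obtain \<zeta> where "cmod \<zeta> \<le> C * sqrt (\<delta> n)" "lam + \<zeta> \<in> quad_spectrum M (P n)"
      by (auto simp: N_def quad_spectrum_translate)
    then show ?thesis by (intro exI[of _ "lam + \<zeta>"]) auto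
  next
    case False
    then show ?thesis using quad_spectrum_nonempty[OF M P sub fin nz] by auto
  qed
  then obtain z where z: "\<And>n. z n \<in> quad_spectrum M (P n)"
    "\<And>n. n \<ge> n0 \<Longrightarrow> cmod (z n - lam) \<le> C * sqrt (\<delta> n)" by metis
  \<comment> \<open>The estimate of order \<open>sqrt (\<delta> n)\<close> holds from n0 on; S accounts for the finitely many earlier n.\<close>
  define S where "S = (\<Sum>n<n0. cmod (z n - lam) / sqrt (\<delta> n))"
  have S: "S \<ge> 0" unfolding S_def using \<delta> by (intro sum_nonneg) (auto simp: less_imp_le)
  have "cmod (z n - lam) < (C + S + 1) * sqrt (\<delta> n)" for n
  proof -
    have s: "sqrt (\<delta> n) > 0" using \<delta> by simp
    have "cmod (z n - lam) \<le> (C + S) * sqrt (\<delta> n)"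
    proof (cases "n \<ge> n0")
      case True
      then show ?thesis using z(2)[OF True] mult_nonneg_nonneg[OF S less_imp_le[OF s]]
        unfolding distrib_right by linarith
    next
      case False
      have "cmod (z n - lam) / sqrt (\<delta> n) \<le> S"
        unfolding S_def using False \<delta> by (intro member_le_sum) (auto simp: less_imp_le)
      then have "cmod (z n - lam) / sqrt (\<delta> n) \<le> C + S" using C by linarith
      then show ?thesis using s by (simp add: pos_divide_le_eq)
    qed
    then show ?thesis using s unfolding distrib_right by linarith
  qed
  moreover have "C + S + 1 > 0" using C S by linarith
  ultimately show ?thesis using z(1) by blast
qed

end
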